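(* Let $f:\mathbb{R}^n\to\mathbb{R}$ be convex and differentiable with $L$-Lipschitz continuous gradient ($L>0$), let $g:\mathbb{R}^n\to(-\infty,+\infty]$ and $h:\mathbb{R}^m\to(-\infty,+\infty]$ be proper, closed and convex, and let $A:\mathbb{R}^n\to\mathbb{R}^m$ be linear. Let $$\mathcal{L}(x,s):=f(x)+g(x)+\langle Ax,s\rangle-h^*(s),$$ and assume that the saddle problem $\min_x\max_s\mathcal{L}(x,s)$ has at least one saddle point $(x^\star,s^\star)$. Let $\tau,\eta>0$ be the primal and dual stepsizes and set $\alpha:=\tau L/2$, $\beta:=\tau\eta\|A\|^2$. Let $\mathcal{A}$ be one of the four algorithms Condat--Vũ, PD3O, PDDY/AFBA, PAPC/PDFP$^2$O defined in the context, with its primal outputs $u_{\mathcal{A}}^k$ and dual outputs $s^{k+1}$, $k\ge 0$, and define the ergodic averages $$\bar u_{\mathcal{A}}^K:=\frac1K\sum_{k=0}^{K-1}u_{\mathcal{A}}^k,\qquad \bar s^K:=\frac1K\sum_{k=0}^{K-1}s^{k+1}.$$ Assume the stepsize condition corresponding to $\mathcal{A}$: (i) Condat--Vũ: $\alpha+\beta<1$; (ii) PD3O: $\alpha<1$ and $\beta\le 1$; (iii) PDDY/AFBA: $\alpha<1$ and $\beta<\dfrac{4\alpha-3+\sqrt{9-8\alpha}}{2\alpha}$; (iv) PAPC/PDFP$^2$O (in this case $g\equiv 0$): $\alpha<1$ and $\beta<4/3$. Then, for every fixed test pair $(x,s)$, there exists a finite constant $C_{\mathcal{A}}(x,s)$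 such that $$\mathcal{L}(\bar u_{\mathcal{A}}^K,s)-\mathcal{L}(x,\bar s^K)\le\frac{C_{\mathcal{A}}(x,s)}{K},\qquad K\ge 1.$$ Consequently, every restricted primal-dual gap $$\sup_{x\in\mathcal{X},\,s\in\mathcal{S}}\{\mathcal{L}(\bar u_{\mathcal{A}}^K,s)-\mathcal{L}(x,\bar s^K)\}$$ over a test set $\mathcal{X}\times\mathcal{S}\subset\mathbb{R}^n\times\mathbb{R}^m$ on which $C_{\mathcal{A}}(x,s)$ is uniformly bounded is $O(1/K)$. In particular, $$0\le \mathcal{L}(\bar u_{\mathcal{A}}^K,s^\star)-\mathcal{L}(x^\star,\bar s^K)\le\frac{C_{\mathcal{A}}(x^\star,s^\star)}{K}.$$
   Context: $\|A\|$ is the spectral norm, $A^\top$ the adjoint, $I$ the identity, $h^*$ the convex conjugate of $h$, and $\operatorname{prox}_{\gamma\varphi}(v):=\arg\min_w\{\varphi(w)+\frac{1}{2\gamma}\|w-v\|^2\}$ for $\gamma>0$ and $\varphi$ proper closed convex. A saddle point $(x^\star,s^\star)$ of $\mathcal{L}$ satisfies $0\in\nabla f(x^\star)+\partial g(x^\star)+A^\top s^\star$ and $0\in\partial h^*(s^\star)-Ax^\star$. The algorithms, for $k\ge 0$, are as follows. Condat--Vũ (initial $x^0\in\mathbb{R}^n$, $s^0\in\mathbb{R}^m$): $$x^{k+1}=\operatorname{prox}_{\tau g}(x^k-\tau\nabla f(x^k)-\tau A^\top s^k),\qquad s^{k+1}=\operatorname{prox}_{\eta h^*}(s^k+\eta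 A(2x^{k+1}-x^k)).$$ Primal output $u^k:=x^{k+1}$, dual output $s^{k+1}$. PD3O (initial $z^0\in\mathbb{R}^n$, $s^0\in\mathbb{R}^m$): $$x^k=\operatorname{prox}_{\tau g}(z^k),$$ $$s^{k+1}=\operatorname{prox}_{\eta h^*}\bigl((I-\tau\eta AA^\top)s^k+\eta A(2x^k-z^k-\tau\nabla f(x^k))\bigr),$$ $$z^{k+1}=x^k-\tau\nabla f(x^k)-\tau A^\top s^{k+1}.$$ Primal output $u^k:=x^k$, dual output $s^{k+1}$. PDDY/AFBA (initial $y^0\in\mathbb{R}^n$, $s^0\in\mathbb{R}^m$): $$s^{k+1}=\operatorname{prox}_{\eta h^*}(s^k+\eta Ay^k),$$ $$x^{k+1}=y^k-\tau A^\top(s^{k+1}-s^k),$$ $$y^{k+1}=\operatorname{prox}_{\tau g}(x^{k+1}-\tau A^\top s^{k+1}-\tau\nabla f(x^{k+1})).$$ Primal output $u^k:=y^k$, dual output $s^{k+1}$. PAPC/PDFP$^2$O ($g\equiv0$; initial $x^0\in\mathbb{R}^n$, $s^0\in\mathbb{R}^m$): $$s^{k+1}=\operatorname{prox}_{\eta h^*}\bigl((I-\tau\eta AA^\top)s^k+\eta A(x^k-\tau\nabla f(x^k))\bigr),$$ $$x^{k+1}=x^k-\tau\nabla f(x^k)-\tau A^\top s^{k+1}.$$ Primal output $u^k:=x^{k+1}$, dual output $s^{k+1}$. The constant $C_{\mathcal{A}}(x,s)$ does not depend on $K$.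
   Formalization: For PDDY/AFBA the initial point is additionally required to satisfy g(y^0) < +∞; otherwise ū^1 = y^0 gives L(ū^1, s* ) = +∞ while L(x*, s̄^1) is finite, so the claimed bound fails at K = 1. *)

theory Defs
  imports "HOL-Analysis.Analysis"
begin

section \<open>Convex analysis for extended-real-valued functions\<close>

definition proper_fun :: "('a \<Rightarrow> ereal) \<Rightarrow> bool" where
  "proper_fun \<phi> \<longleftrightarrow> (\<forall>x. \<phi> x \<noteq> - \<infinity>) \<and> (\<exists>x. \<phi> x \<noteq> \<infinity>)"

text \<open>The library's \<^const>\<open>epigraph\<close> is for real-valued functions only. As usual, closedness and
  convexity of an extended-real-valued function are those of its epigraph.\<close>

definition epi :: "('a \<Rightarrow> ereal) \<Rightarrow> ('a \<times> real) set" where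
  "epi \<phi> = {(x, r). \<phi> x \<le> ereal r}"

definition proper_closed_convex :: "('a::euclidean_space \<Rightarrow> ereal) \<Rightarrow> bool" where
  "proper_closed_convex \<phi> \<longleftrightarrow> proper_fun \<phi> \<and> closed (epi \<phi>) \<and> convex (epi \<phi>)"

definition conjugate :: "('a::euclidean_space \<Rightarrow> ereal) \<Rightarrow> 'a \<Rightarrow> ereal" where
  "conjugate h s = (SUP y. ereal (y \<bullet> s) - h y)"

definition subdifferential :: "('a::euclidean_space \<Rightarrow> ereal) \<Rightarrow> 'a \<Rightarrow> 'a set" where
  "subdifferential \<phi> x = {v. \<forall>y. \<phi> x + ereal (v \<bullet> (y - x)) \<le> \<phi> y}"

text \<open>For \<open>\<gamma> > 0\<close> and proper closed convex \<open>\<phi>\<close> the minimiser exists and is unique, so the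
  choice made by \<^const>\<open>arg_min\<close> is immaterial.\<close>

definition prox :: "real \<Rightarrow> ('a::euclidean_space \<Rightarrow> ereal) \<Rightarrow> 'a \<Rightarrow> 'a" where
  "prox \<gamma> \<phi> v = (ARG_MIN (\<lambda>w. \<phi> w + ereal (1 / (2 * \<gamma>) * (norm (w - v))\<^sup>2)) w. True)"


section \<open>The saddle problem\<close>

text \<open>In \<^typ>\<open>ereal\<close>, \<open>\<infinity> - \<infinity> = \<infinity>\<close>, so the value below is \<open>\<infinity>\<close> if \<open>g x\<close> and
  \<open>conjugate h s\<close> are both infinite.\<close>

definition lagrangian ::
  "('a::euclidean_space \<Rightarrow> real) \<Rightarrow> ('a \<Rightarrow> ereal) \<Rightarrow> ('b::euclidean_space \<Rightarrow> ereal) \<Rightarrow>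
   ('a \<Rightarrow> 'b) \<Rightarrow> 'a \<Rightarrow> 'b \<Rightarrow> ereal" where
  "lagrangian f g h A x s = ereal (f x) + g x + ereal (A x \<bullet> s) - conjugate h s"

text \<open>Saddle point of the min-max problem: minimum in the first, maximum in the second argument.\<close>

definition saddle_point :: "('a \<Rightarrow> 'b \<Rightarrow> ereal) \<Rightarrow> 'a \<Rightarrow> 'b \<Rightarrow> bool" where
  "saddle_point F xs ss \<longleftrightarrow> (\<forall>x s. F xs s \<le> F xs ss \<and> F xs ss \<le> F x ss)"

lemma saddle_point_lagrangian_finite:
  assumes g: "proper_fun g" and h: "proper_fun (conjugate h)"
    and sp: "saddle_point (lagrangian f g h A) xs ss"
  shows "\<bar>g xs\<bar> \<noteq> \<infinity>" "\<bar>conjugate h ss\<bar> \<noteq> \<infinity>"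
proof -
  obtain x0 s0 where x0: "g x0 \<noteq> \<infinity>" and s0: "conjugate h s0 \<noteq> \<infinity>"
    using g h by (auto simp: proper_fun_def)
  have ninf: "g x \<noteq> - \<infinity>" "conjugate h s \<noteq> - \<infinity>" for x s
    using g h by (auto simp: proper_fun_def)
  have le1: "lagrangian f g h A xs ss \<le> lagrangian f g h A x0 ss"
    and le2: "lagrangian f g h A xs s0 \<le> lagrangian f g h A xs ss"
    using sp by (auto simp: saddle_point_def)
  have g1: "g xs \<noteq> \<infinity>"
    using le1 x0 ninf(1)[of x0] ninf(2)[of ss]
    by (cases "g x0"; cases "conjugate h ss") (auto simp: lagrangian_def)
  show "\<bar>g xs\<bar> \<noteq> \<infinity>" using g1 ninf by auto
  have "conjugate h ss \<noteq> \<infinity>"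
    using le2 s0 g1 ninf(1)[of xs] ninf(2)[of s0]
    by (cases "g xs"; cases "conjugate h s0") (auto simp: lagrangian_def)
  then show "\<bar>conjugate h ss\<bar> \<noteq> \<infinity>" using ninf by auto
qed

text \<open>Equivalent optimality system.\<close>

lemma saddle_point_lagrangian_iff:
  fixes A :: "'a::euclidean_space \<Rightarrow> 'b::euclidean_space"
  assumes f: "convex_on UNIV f" and df: "\<And>x. GDERIV f x :> df x"
    and g: "proper_closed_convex g" and h: "proper_fun (conjugate h)" and A: "linear A"
  shows "saddle_point (lagrangian f g h A) xs ss \<longleftrightarrow>
    0 \<in> {df xs + v + adjoint A ss | v. v \<in> subdifferential g xs} \<and>
    0 \<in> {w - A xs | w. w \<in> subdifferential (conjugate h) ss}"
    (is "?S \<longleftrightarrow> ?P \<and> ?D")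
proof -
  define k where "k = conjugate h"
  have gp: "proper_fun g" and ge: "convex (epi g)" using g by (auto simp: proper_closed_convex_def)
  have ninf: "g x \<noteq> - \<infinity>" "k s \<noteq> - \<infinity>" for x s
    using gp h by (auto simp: proper_fun_def k_def)
  have P: "?P \<longleftrightarrow> - df xs - adjoint A ss \<in> subdifferential g xs"
    by (auto simp: eq_neg_iff_add_eq_0 algebra_simps)
       (metis add.commute add.left_commute add_diff_cancel_left' diff_0 diff_minus_eq_add minus_add_distrib uminus_add_conv_diff add_eq_0_iff, 
        metis add.inverse_inverse add.right_inverse minus_add_distrib uminus_add_conv_diff add.commute)
  have D: "?D \<longleftrightarrow> A xs \<in> subdifferential k ss" by (auto simp: k_def)
  have adj: "adjoint A s \<bullet> x = A x \<bullet> s" for x s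
    using adjoint_works[OF A, of x s] by (simp add: inner_commute)
  have fd: "((\<lambda>t. (f (xs + t *\<^sub>R d) - f xs) / t) \<longlongrightarrow> df xs \<bullet> d) (at_right 0)" for d
  proof -
    have 1: "(f has_derivative (\<lambda>v. v \<bullet> df xs)) (at (xs + 0 *\<^sub>R d))"
      using df[of xs] by (simp add: gderiv_def)
    have 2: "((\<lambda>t. xs + t *\<^sub>R d) has_derivative (\<lambda>t. t *\<^sub>R d)) (at 0)"
      by (auto intro!: derivative_eq_intros)
    have "((\<lambda>t. f (xs + t *\<^sub>R d)) has_derivative (\<lambda>t. (t *\<^sub>R d) \<bullet> df xs)) (at 0)"
      by (rule has_derivative_compose[OF 2 1])
    then have "((\<lambda>t. f (xs + t *\<^sub>R d)) has_field_derivative (df xs \<bullet> d)) (at 0)"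
      by (simp add: has_field_derivative_def inner_commute mult.commute[of _ "d \<bullet> df xs"] mult_commute_abs)
    then have "((\<lambda>t. (f (xs + t *\<^sub>R d) - f xs) / t) \<longlongrightarrow> df xs \<bullet> d) (at 0)"
      by (simp add: has_field_derivative_iff)
    then show ?thesis by (rule filterlim_mono) (auto simp: at_le)
  qed
  have gc: "g (xs + t *\<^sub>R (y - xs)) \<le> ereal ((1 - t) * a + t * b)"
    if "g xs = ereal a" "g y = ereal b" "0 < t" "t < 1" for y a b t
  proof -
    have "(1 - t) *\<^sub>R (xs, a) + t *\<^sub>R (y, b) \<in> epi g"
      using ge that by (intro convexD) (auto simp: epi_def)
    moreover have "xs + t *\<^sub>R (y - xs) = (1 - t) *\<^sub>R xs + t *\<^sub>R y" by (simp add: algebra_simps)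
    ultimately show ?thesis by (simp add: epi_def)
  qed
  have fge: "df xs \<bullet> d \<le> f (xs + d) - f xs" for d
  proof (rule tendsto_upperbound[OF fd])
    show "\<forall>\<^sub>F t in at_right 0. (f (xs + t *\<^sub>R d) - f xs) / t \<le> f (xs + d) - f xs"
      using eventually_at_right_less[of "0::real"] eventually_at_right_real[of 0 "1::real", simplified]
    proof eventually_elim
      case (elim t)
      have "f ((1 - t) *\<^sub>R xs + t *\<^sub>R (xs + d)) \<le> (1 - t) * f xs + t * f (xs + d)"
        using elim by (intro convex_onD[OF f]) auto
      then have "f (xs + t *\<^sub>R d) - f xs \<le> t * (f (xs + d) - f xs)"
        by (simp add: algebra_simps)
      then show ?case using elim by (simp add: field_simps)
    qed
  qed auto
  show ?thesis unfolding P D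
  proof (intro iffI conjI)
    assume S: ?S
    obtain a where a: "g xs = ereal a"
      using saddle_point_lagrangian_finite(1)[OF gp h S] by auto
    obtain b where b: "k ss = ereal b"
      using saddle_point_lagrangian_finite(2)[OF gp h S] by (auto simp: k_def)
    have le: "lagrangian f g h A xs s \<le> lagrangian f g h A xs ss"
      "lagrangian f g h A xs ss \<le> lagrangian f g h A x ss" for x s
      using S by (auto simp: saddle_point_def)
    show "A xs \<in> subdifferential k ss"
      unfolding subdifferential_def
    proof (intro CollectI allI)
      fix s
      show "k ss + ereal (A xs \<bullet> (s - ss)) \<le> k s"
        using le(1)[of s] ninf(2)[of s] a b
        by (cases "k s") (auto simp: lagrangian_def k_def[symmetric] inner_diff_right)
    qed
    show "- df xs - adjoint A ss \<in> subdifferential g xs"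
      unfolding subdifferential_def
    proof (intro CollectI allI)
      fix y
      show "g xs + ereal ((- df xs - adjoint A ss) \<bullet> (y - xs)) \<le> g y"
      proof (cases "g y")
        case (real c)
        let ?d = "y - xs"
        have "a - c - A ?d \<bullet> ss \<le> df xs \<bullet> ?d"
        proof (rule tendsto_lowerbound[OF fd])
          show "\<forall>\<^sub>F t in at_right 0. a - c - A ?d \<bullet> ss \<le> (f (xs + t *\<^sub>R ?d) - f xs) / t"
            using eventually_at_right_less[of "0::real"] eventually_at_right_real[of 0 "1::real", simplified]
          proof eventually_elim
            case (elim t)
            have gt: "g (xs + t *\<^sub>R ?d) \<le> ereal ((1 - t) * a + t * c)"
              using gc[OF a real] elim by auto
            have At: "A (xs + t *\<^sub>R ?d) \<bullet> ss = A xs \<bullet> ss + t * (A ?d \<bullet> ss)"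
              by (simp only: linear_add[OF A] linear_scale[OF A] inner_add_left inner_scaleR_left)
            have "f xs + a + A xs \<bullet> ss \<le> f (xs + t *\<^sub>R ?d) + ((1 - t) * a + t * c) + A (xs + t *\<^sub>R ?d) \<bullet> ss"
              using le(2)[of "xs + t *\<^sub>R ?d"] gt ninf(1)[of "xs + t *\<^sub>R ?d"] a b
              by (cases "g (xs + t *\<^sub>R ?d)") (auto simp: lagrangian_def k_def[symmetric])
            then have "t * (a - c - A ?d \<bullet> ss) \<le> f (xs + t *\<^sub>R ?d) - f xs"
              unfolding At by (simp add: left_diff_distrib right_diff_distrib)
            then show ?case using elim by (simp add: field_simps)
          qed
        qed auto
        then show ?thesis
          by (simp add: a real inner_diff_left adj)
      qed (use ninf in auto)
    qed
  next
    assume "- df xs - adjoint A ss \<in> subdifferential g xs \<and> A xs \<in> subdifferential k ss"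
    then have sg: "g xs + ereal ((- df xs - adjoint A ss) \<bullet> (y - xs)) \<le> g y"
      and sk: "k ss + ereal (A xs \<bullet> (s - ss)) \<le> k s" for y s
      by (auto simp: subdifferential_def)
    obtain x0 s0 where "g x0 \<noteq> \<infinity>" "k s0 \<noteq> \<infinity>"
      using gp h by (auto simp: proper_fun_def k_def)
    then obtain a b where a: "g xs = ereal a" and b: "k ss = ereal b"
      using sg[of x0] sk[of s0] ninf(1)[of xs] ninf(2)[of ss]
      by (cases "g xs"; cases "k ss") auto
    show ?S
      unfolding saddle_point_def
    proof (intro allI conjI)
      fix x s
      show "lagrangian f g h A xs s \<le> lagrangian f g h A xs ss"
        using sk[of s] ninf(2)[of s] a b
        by (cases "k s") (auto simp: lagrangian_def k_def[symmetric] inner_diff_right)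
      show "lagrangian f g h A xs ss \<le> lagrangian f g h A x ss"
      proof (cases "g x")
        case (real c)
        have "df xs \<bullet> (x - xs) \<le> f x - f xs" using fge[of "x - xs"] by simp
        moreover have "a - df xs \<bullet> (x - xs) - (A x \<bullet> ss - A xs \<bullet> ss) \<le> c"
          using sg[of x] by (simp add: a real inner_diff_left adj linear_diff[OF A])
        ultimately show ?thesis
          by (simp add: lagrangian_def k_def[symmetric] a b real)
      qed (use ninf b in \<open>auto simp: lagrangian_def k_def[symmetric]\<close>)
    qed
  qed
qed


section \<open>The algorithms\<close>

text \<open>Each predicate says that the sequences satisfy the recursion for all \<open>k \<ge> 0\<close>; the values
  that the recursion leaves free at index 0 are the arbitrary initial points. \<open>df\<close> is the gradient
  of \<open>f\<close>.\<close>

definition condat_vu ::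
  "real \<Rightarrow> real \<Rightarrow> ('a::euclidean_space \<Rightarrow> 'a) \<Rightarrow> ('a \<Rightarrow> ereal) \<Rightarrow>
   ('b::euclidean_space \<Rightarrow> ereal) \<Rightarrow> ('a \<Rightarrow> 'b) \<Rightarrow> (nat \<Rightarrow> 'a) \<Rightarrow> (nat \<Rightarrow> 'b) \<Rightarrow> bool" where
  "condat_vu \<tau> \<eta> df g h A x s \<longleftrightarrow> (\<forall>k.
     x (Suc k) = prox \<tau> g (x k - \<tau> *\<^sub>R df (x k) - \<tau> *\<^sub>R adjoint A (s k)) \<and>
     s (Suc k) = prox \<eta> (conjugate h) (s k + \<eta> *\<^sub>R A (2 *\<^sub>R x (Suc k) - x k)))"

definition pd3o ::
  "real \<Rightarrow> real \<Rightarrow> ('a::euclidean_space \<Rightarrow> 'a) \<Rightarrow> ('a \<Rightarrow> ereal) \<Rightarrow>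
   ('b::euclidean_space \<Rightarrow> ereal) \<Rightarrow> ('a \<Rightarrow> 'b) \<Rightarrow>
   (nat \<Rightarrow> 'a) \<Rightarrow> (nat \<Rightarrow> 'a) \<Rightarrow> (nat \<Rightarrow> 'b) \<Rightarrow> bool" where
  "pd3o \<tau> \<eta> df g h A x z s \<longleftrightarrow> (\<forall>k.
     x k = prox \<tau> g (z k) \<and>
     s (Suc k) = prox \<eta> (conjugate h)
       (s k - (\<tau> * \<eta>) *\<^sub>R A (adjoint A (s k)) + \<eta> *\<^sub>R A (2 *\<^sub>R x k - z k - \<tau> *\<^sub>R df (x k))) \<and>
     z (Suc k) = x k - \<tau> *\<^sub>R df (x k) - \<tau> *\<^sub>R adjoint A (s (Suc k)))"

text \<open>Here \<open>x 0\<close> is unused. The initial point \<open>y 0\<close> is itself a primal output; unlike the later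
  ones it is not the result of a prox step, so \<open>g (y 0)\<close> may be infinite.\<close>

definition pddy ::
  "real \<Rightarrow> real \<Rightarrow> ('a::euclidean_space \<Rightarrow> 'a) \<Rightarrow> ('a \<Rightarrow> ereal) \<Rightarrow>
   ('b::euclidean_space \<Rightarrow> ereal) \<Rightarrow> ('a \<Rightarrow> 'b) \<Rightarrow>
   (nat \<Rightarrow> 'a) \<Rightarrow> (nat \<Rightarrow> 'a) \<Rightarrow> (nat \<Rightarrow> 'b) \<Rightarrow> bool" where
  "pddy \<tau> \<eta> df g h A x y s \<longleftrightarrow> (\<forall>k.
     s (Suc k) = prox \<eta> (conjugate h) (s k + \<eta> *\<^sub>R A (y k)) \<and>
     x (Suc k) = y k - \<tau> *\<^sub>R adjoint A (s (Suc k) - s k) \<and>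
     y (Suc k) = prox \<tau> g (x (Suc k) - \<tau> *\<^sub>R adjoint A (s (Suc k)) - \<tau> *\<^sub>R df (x (Suc k))))"

definition papc ::
  "real \<Rightarrow> real \<Rightarrow> ('a::euclidean_space \<Rightarrow> 'a) \<Rightarrow>
   ('b::euclidean_space \<Rightarrow> ereal) \<Rightarrow> ('a \<Rightarrow> 'b) \<Rightarrow> (nat \<Rightarrow> 'a) \<Rightarrow> (nat \<Rightarrow> 'b) \<Rightarrow> bool" where
  "papc \<tau> \<eta> df h A x s \<longleftrightarrow> (\<forall>k.
     s (Suc k) = prox \<eta> (conjugate h)
       (s k - (\<tau> * \<eta>) *\<^sub>R A (adjoint A (s k)) + \<eta> *\<^sub>R A (x k - \<tau> *\<^sub>R df (x k))) \<and>
     x (Suc k) = x k - \<tau> *\<^sub>R df (x k) - \<tau> *\<^sub>R adjoint A (s (Suc k)))"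

datatype algorithm = CondatVu | PD3O | PDDY | PAPC

text \<open>\<open>u\<close> is the sequence of primal outputs and \<open>s\<close> the sequence of dual iterates of some run of
  the algorithm; the dual outputs are \<open>s (Suc k)\<close>.\<close>

fun generates ::
  "algorithm \<Rightarrow> real \<Rightarrow> real \<Rightarrow> ('a::euclidean_space \<Rightarrow> 'a) \<Rightarrow> ('a \<Rightarrow> ereal) \<Rightarrow>
   ('b::euclidean_space \<Rightarrow> ereal) \<Rightarrow> ('a \<Rightarrow> 'b) \<Rightarrow> (nat \<Rightarrow> 'a) \<Rightarrow> (nat \<Rightarrow> 'b) \<Rightarrow> bool" where
  "generates CondatVu \<tau> \<eta> df g h A u s \<longleftrightarrow>
     (\<exists>x. condat_vu \<tau> \<eta> df g h A x s \<and> (\<forall>k. u k = x (Suc k)))"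
| "generates PD3O \<tau> \<eta> df g h A u s \<longleftrightarrow>
     (\<exists>x z. pd3o \<tau> \<eta> df g h A x z s \<and> (\<forall>k. u k = x k))"
| "generates PDDY \<tau> \<eta> df g h A u s \<longleftrightarrow>
     (\<exists>x y. pddy \<tau> \<eta> df g h A x y s \<and> (\<forall>k. u k = y k))"
| "generates PAPC \<tau> \<eta> df g h A u s \<longleftrightarrow>
     (\<exists>x. papc \<tau> \<eta> df h A x s \<and> (\<forall>k. u k = x (Suc k)))"

fun stepsize_condition :: "algorithm \<Rightarrow> real \<Rightarrow> real \<Rightarrow> bool" where
  "stepsize_condition CondatVu \<alpha> \<beta> \<longleftrightarrow> \<alpha> + \<beta> < 1"
| "stepsize_condition PD3O \<alpha> \<beta> \<longleftrightarrow> \<alpha> < 1 \<and> \<beta> \<le> 1"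
| "stepsize_condition PDDY \<alpha> \<beta> \<longleftrightarrow>
     \<alpha> < 1 \<and> \<beta> < (4 * \<alpha> - 3 + sqrt (9 - 8 * \<alpha>)) / (2 * \<alpha>)"
| "stepsize_condition PAPC \<alpha> \<beta> \<longleftrightarrow> \<alpha> < 1 \<and> \<beta> < 4 / 3"

definition ergodic_average :: "(nat \<Rightarrow> 'a::real_vector) \<Rightarrow> nat \<Rightarrow> 'a" where
  "ergodic_average v K = (1 / real K) *\<^sub>R (\<Sum>k<K. v k)"

end

theory Submission
  imports Defs
begin

text \<open>One step of each algorithm bounds the Lagrangian gap at a test pair by a telescoping
  difference plus squared residuals of the step. These residuals are absorbed by the telescoping part
  only under smaller stepsizes. However, at a saddle point \<open>f\<close> may be replaced by its
  linearisation, and cocoercivity of the gradient is then strong enough that, under the stated stepsize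
  conditions, a Lyapunov function decreases by at least a multiple of the squared residuals. So the
  residuals are square summable, hence harmless at every test pair as well, and convexity of the
  Lagrangian in the first and concavity in the second argument transfer the bound to the averages.

  For PD3O, the test inequality is centred at the gradient at the saddle point rather than at the test
  point, so that its error term is a product of two square summable residuals. For PAPC and PDDY,
  \<open>\<beta>\<close> may exceed 1 and the squared dual step then enters with a negative part: in PAPC
  this part is controlled because
  \<open>A\<^sup>T (s\<^sup>k - s\<^sup>*)\<close> is itself one of the residuals; in PDDY one
  adds a multiple of the monotonicity inequality between two consecutive dual steps, and the best
  multiple yields exactly the stepsize bound.\<close>

section \<open>Convex analysis\<close>

text \<open>Separate from the epigraph a point just below the graph over the domain. Since
  \<open>(x0, r0)\<close> lies vertically above that point and on the other side, the hyperplane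
  cannot be vertical, and it can be solved for the last coordinate.\<close>

lemma proper_closed_convex_affine_minorant:
  fixes \<phi> :: "'a::euclidean_space \<Rightarrow> ereal"
  assumes "proper_closed_convex \<phi>"
  obtains a b where "\<And>x. ereal (a \<bullet> x + b) \<le> \<phi> x"
proof -
  have p: "proper_fun \<phi>" and cl: "closed (epi \<phi>)" and cv: "convex (epi \<phi>)"
    using assms by (auto simp: proper_closed_convex_def)
  obtain x0 r0 where r0: "\<phi> x0 = ereal r0"
    using p unfolding proper_fun_def by (metis ereal_cases)
  have "(x0, r0 - 1) \<notin> epi \<phi>" by (simp add: epi_def r0)
  then obtain w c where w: "w \<bullet> (x0, r0 - 1) < c" "\<And>z. z \<in> epi \<phi> \<Longrightarrow> c < w \<bullet> z"
    using separating_hyperplane_closed_point[OF cv cl] by blast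
  obtain a t where [simp]: "w = (a, t)" by (cases w)
  have "c < a \<bullet> x0 + t * r0" using w(2)[of "(x0, r0)"] by (simp add: epi_def r0)
  then have t: "0 < t" using w(1) by (simp add: algebra_simps)
  show ?thesis
  proof (rule that)
    fix x
    show "ereal ((- (1 / t) *\<^sub>R a) \<bullet> x + c / t) \<le> \<phi> x"
    proof (cases "\<phi> x")
      case (real r)
      then have "c < a \<bullet> x + t * r" using w(2)[of "(x, r)"] by (simp add: epi_def)
      then show ?thesis using t by (simp add: real field_simps)
    qed (use p in \<open>auto simp: proper_fun_def\<close>)
  qed
qed

text \<open>The epigraph of the conjugate is an intersection of half-spaces, one for each
  \<open>y\<close> in the domain of \<open>h\<close>. The conjugate is finite at the slope of an
  affine minorant of \<open>h\<close>.\<close>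

lemma proper_closed_convex_conjugate:
  fixes h :: "'a::euclidean_space \<Rightarrow> ereal"
  assumes h: "proper_closed_convex h"
  shows "proper_closed_convex (conjugate h)"
proof -
  have p: "\<And>y. h y \<noteq> - \<infinity>" using h by (auto simp: proper_closed_convex_def proper_fun_def)
  obtain y0 r0 where r0: "h y0 = ereal r0"
    using h unfolding proper_closed_convex_def proper_fun_def by (metis ereal_cases)
  obtain a b where ab: "\<And>y. ereal (a \<bullet> y + b) \<le> h y"
    using proper_closed_convex_affine_minorant[OF h] by blast
  have "ereal (y0 \<bullet> s) - h y0 \<le> conjugate h s" for s
    unfolding conjugate_def by (rule SUP_upper) simp
  then have 1: "conjugate h s \<noteq> - \<infinity>" for s
    by (metis MInfty_neq_ereal(1) ereal_infty_less_eq(2) ereal_minus(1) r0)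
  have "ereal (y \<bullet> a) - h y \<le> ereal (- b)" for y
    using ab[of y] p[of y] by (cases "h y") (auto simp: inner_commute)
  then have "conjugate h a \<le> ereal (- b)"
    unfolding conjugate_def by (intro SUP_least)
  then have 2: "conjugate h a \<noteq> \<infinity>" by auto
  define S where "S y = {(s, r). ereal (y \<bullet> s) - h y \<le> ereal r}" for y
  have e: "epi (conjugate h) = (\<Inter>y. S y)"
    by (auto simp: epi_def S_def conjugate_def SUP_le_iff)
  have S: "closed (S y) \<and> convex (S y)" for y
  proof (cases "h y")
    case (real c)
    then have "S y = {z. (y, - 1) \<bullet> z \<le> c}" by (auto simp: S_def)
    then show ?thesis using closed_halfspace_le convex_halfspace_le by metis
  next
    case PInf
    then have "S y = UNIV" by (auto simp: S_def)
    then show ?thesis by simp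
  qed (use p in auto)
  show ?thesis
    unfolding proper_closed_convex_def proper_fun_def e
    using 1 2 S by (auto intro!: closed_INT convex_INT)
qed

section \<open>Passage from extended-real to real inequalities\<close>

lemma subdifferential_real:
  assumes \<phi>: "proper_fun \<phi>" and v: "v \<in> subdifferential \<phi> p"
  shows "\<phi> p \<noteq> \<infinity>"
    and "\<phi> y \<noteq> \<infinity> \<Longrightarrow> real_of_ereal (\<phi> p) + v \<bullet> (y - p) \<le> real_of_ereal (\<phi> y)"
proof -
  have n: "\<phi> x \<noteq> - \<infinity>" for x using \<phi> by (auto simp: proper_fun_def)
  have i: "\<phi> p + ereal (v \<bullet> (x - p)) \<le> \<phi> x" for x using v by (auto simp: subdifferential_def)
  obtain x0 where "\<phi> x0 \<noteq> \<infinity>" using \<phi> by (auto simp: proper_fun_def)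
  then show 1: "\<phi> p \<noteq> \<infinity>" using i[of x0] by auto
  show "real_of_ereal (\<phi> p) + v \<bullet> (y - p) \<le> real_of_ereal (\<phi> y)" if "\<phi> y \<noteq> \<infinity>"
    using i[of y] 1 that n[of p] n[of y] by (cases "\<phi> p"; cases "\<phi> y") auto
qed

lemma convex_on_real_of_ereal:
  fixes \<phi> :: "'a::euclidean_space \<Rightarrow> ereal"
  assumes \<phi>: "proper_closed_convex \<phi>"
  shows "convex_on {x. \<phi> x \<noteq> \<infinity>} (\<lambda>x. real_of_ereal (\<phi> x))"
proof -
  have n: "\<And>x. \<phi> x \<noteq> - \<infinity>" and c: "convex (epi \<phi>)"
    using \<phi> by (auto simp: proper_closed_convex_def proper_fun_def)
  have le: "\<phi> (a *\<^sub>R x + b *\<^sub>R y) \<le> ereal (a * real_of_ereal (\<phi> x) + b * real_of_ereal (\<phi> y))"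
    if "\<phi> x \<noteq> \<infinity>" "\<phi> y \<noteq> \<infinity>" "0 \<le> a" "0 \<le> b" "a + b = 1" for x y a b
  proof -
    have "(x, real_of_ereal (\<phi> x)) \<in> epi \<phi>" "(y, real_of_ereal (\<phi> y)) \<in> epi \<phi>"
      using that n by (auto simp: epi_def ereal_real)
    from convexD[OF c this that(3-5)] show ?thesis by (simp add: epi_def)
  qed
  show ?thesis
  proof (rule convex_onI)
    fix t :: real and x y assume *: "0 < t" "t < 1" "x \<in> {x. \<phi> x \<noteq> \<infinity>}" "y \<in> {x. \<phi> x \<noteq> \<infinity>}"
    then show "real_of_ereal (\<phi> ((1 - t) *\<^sub>R x + t *\<^sub>R y)) \<le>
        (1 - t) * real_of_ereal (\<phi> x) + t * real_of_ereal (\<phi> y)"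
      using le[of x y "1 - t" t] n[of "(1 - t) *\<^sub>R x + t *\<^sub>R y"]
      by (cases "\<phi> ((1 - t) *\<^sub>R x + t *\<^sub>R y)") auto
  next
    show "convex {x. \<phi> x \<noteq> \<infinity>}"
    proof (rule convexI)
      fix x y a b assume "x \<in> {x. \<phi> x \<noteq> \<infinity>}" "y \<in> {x. \<phi> x \<noteq> \<infinity>}" "0 \<le> a" "0 \<le> b" "a + b = (1::real)"
      then show "a *\<^sub>R x + b *\<^sub>R y \<in> {x. \<phi> x \<noteq> \<infinity>}" using le[of x y a b] by auto
    qed
  qed
qed

text \<open>As \<open>prox\<close> is an \<open>ARG_MIN\<close>, it says nothing until a minimiser
  is known to exist. Existence comes from compactness; the subgradient then comes from comparing
  \<open>p\<close> with nearby points on the segment towards \<open>y\<close>.\<close>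

lemma prox_subdifferential:
  fixes \<phi> :: "'a::euclidean_space \<Rightarrow> ereal"
  assumes \<phi>: "proper_closed_convex \<phi>" and \<gamma>: "\<gamma> > 0" and p: "p = prox \<gamma> \<phi> v"
  shows "(1 / \<gamma>) *\<^sub>R (v - p) \<in> subdifferential \<phi> p"
proof -
  have n: "\<And>x. \<phi> x \<noteq> - \<infinity>" and cl: "closed (epi \<phi>)" and pf: "proper_fun \<phi>"
    using \<phi> by (auto simp: proper_closed_convex_def proper_fun_def)
  define q where "q w = 1 / (2 * \<gamma>) * (norm (w - v))\<^sup>2" for w
  define J where "J w = \<phi> w + ereal (q w)" for w
  obtain x0 r0 where r0: "\<phi> x0 = ereal r0"
    using pf unfolding proper_fun_def by (metis ereal_cases)
  obtain a b where ab: "\<And>x. ereal (a \<bullet> x + b) \<le> \<phi> x"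
    using proper_closed_convex_affine_minorant[OF \<phi>] by blast
  define c where "c = r0 + q x0"
  \<comment> \<open>Minimising over pairs \<open>(w, r)\<close> in the epigraph makes the objective
    \<open>r + q w\<close> continuous, so closedness of \<open>epi\<close> takes the place of lower
    semicontinuity. The level \<open>c\<close> is the value at \<open>x0\<close>, hence
    \<open>S\<close> is nonempty.\<close>
  define S where "S = epi \<phi> \<inter> {(w, r). r + q w \<le> c}"
  have q_cont: "continuous_on UNIV (\<lambda>z. snd z + q (fst z))"
    unfolding q_def by (intro continuous_intros)
  have "closed {z. snd z + q (fst z) \<le> c}"
    by (rule closed_Collect_le[OF q_cont]) simp
  then have S_cl: "closed S"
    unfolding S_def using cl by (auto simp: case_prod_beta')
  \<comment> \<open>The affine minorant of \<open>\<phi>\<close> yields a quadratic inequality for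
    the distance from \<open>v\<close>, labelled \<open>d\<close> below. \<open>R\<close> exceeds 1
    and doubles both of its coefficients, so a distance beyond \<open>R\<close> contradicts
    it.\<close>
  define R where "R = 1 + 4 * \<gamma> * norm a + 4 * \<gamma> * \<bar>c - b - a \<bullet> v\<bar>"
  have S_sub: "S \<subseteq> cball v R \<times> {- (norm a * (norm v + R)) + b .. c}"
  proof
    fix z assume "z \<in> S"
    then obtain w r where z: "z = (w, r)" and wr: "\<phi> w \<le> ereal r" "r + q w \<le> c"
      by (auto simp: S_def epi_def)
    have r: "a \<bullet> w + b \<le> r" using order_trans[OF ab wr(1)] by simp
    let ?d = "norm (w - v)"
    have aw: "a \<bullet> w - a \<bullet> v \<ge> - (norm a * ?d)"
      using Cauchy_Schwarz_ineq2[of a "w - v"] by (simp add: inner_diff_right)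
    have "q w \<le> c - b - a \<bullet> v + norm a * ?d" using r wr(2) aw by simp
    then have "?d\<^sup>2 \<le> 2 * \<gamma> * (c - b - a \<bullet> v + norm a * ?d)"
      unfolding q_def using \<gamma> by (simp add: field_simps)
    also have "\<dots> \<le> 2 * \<gamma> * (\<bar>c - b - a \<bullet> v\<bar> + norm a * ?d)" using \<gamma> by (intro mult_left_mono) auto
    finally have d: "?d\<^sup>2 \<le> 2 * \<gamma> * \<bar>c - b - a \<bullet> v\<bar> + 2 * \<gamma> * norm a * ?d" by (simp add: algebra_simps)
    have dR: "?d \<le> R"
    proof (rule ccontr)
      assume "\<not> ?d \<le> R"
      then have h: "R < ?d" by simp
      have g0: "0 \<le> \<gamma> * norm a" "0 \<le> \<gamma> * \<bar>c - b - a \<bullet> v\<bar>" using \<gamma> by auto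
      have R1: "1 \<le> R" using g0 unfolding R_def by simp
      have "R * ?d \<le> ?d\<^sup>2" using h by (simp add: power2_eq_square mult_right_mono)
      moreover have "\<gamma> * \<bar>c - b - a \<bullet> v\<bar> \<le> \<gamma> * \<bar>c - b - a \<bullet> v\<bar> * ?d"
        using g0 h R1 mult_left_mono[of 1 ?d "\<gamma> * \<bar>c - b - a \<bullet> v\<bar>"] by simp
      moreover have "0 \<le> \<gamma> * norm a * ?d" "0 \<le> \<gamma> * \<bar>c - b - a \<bullet> v\<bar> * ?d" using \<gamma> by auto
      moreover have "R * ?d = ?d + 4 * (\<gamma> * norm a * ?d) + 4 * (\<gamma> * \<bar>c - b - a \<bullet> v\<bar> * ?d)"
        unfolding R_def by (simp add: algebra_simps)
      ultimately show False using d h R1 by linarith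
    qed
    have "0 \<le> q w" unfolding q_def using \<gamma> by simp
    moreover have "- (norm a * (norm v + R)) \<le> a \<bullet> w"
    proof -
      have "norm w \<le> norm v + R" using dR norm_triangle_sub[of w v] by simp
      then have "norm a * norm w \<le> norm a * (norm v + R)" by (simp add: mult_left_mono)
      then show ?thesis using Cauchy_Schwarz_ineq2[of a w] by linarith
    qed
    ultimately show "z \<in> cball v R \<times> {- (norm a * (norm v + R)) + b .. c}"
      using z r wr(2) dR by (auto simp: dist_norm norm_minus_commute)
  qed
  have "bounded S"
    by (rule bounded_subset[OF _ S_sub]) (intro bounded_Times bounded_cball bounded_closed_interval)
  then have S_cpt: "compact S" using S_cl by (simp add: compact_eq_bounded_closed)
  have S0: "(x0, r0) \<in> S" by (simp add: S_def epi_def r0 c_def)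
  obtain z where z: "z \<in> S" "\<And>z'. z' \<in> S \<Longrightarrow> snd z + q (fst z) \<le> snd z' + q (fst z')"
    using continuous_attains_inf[OF S_cpt _ continuous_on_subset[OF q_cont subset_UNIV]] S0 by blast
  define m where "m = fst z"
  have zm: "\<phi> m \<le> ereal (snd z)" "snd z + q m \<le> c" using z(1) by (auto simp: S_def epi_def m_def)
  have min: "J m \<le> J w" for w
  proof (cases "\<phi> w")
    case (real r)
    have "snd z + q m \<le> r + q w"
    proof (cases "r + q w \<le> c")
      case True
      then show ?thesis using z(2)[of "(w, r)"] real by (simp add: S_def epi_def m_def)
    qed (use zm in simp)
    then have "ereal (snd z) + ereal (q m) \<le> J w" by (simp add: J_def real)
    moreover have "J m \<le> ereal (snd z) + ereal (q m)" unfolding J_def by (intro add_right_mono zm)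
    ultimately show ?thesis by (rule order_trans[rotated])
  qed (use n in \<open>auto simp: J_def\<close>)
  have "p = arg_min J (\<lambda>_. True)" unfolding p prox_def J_def q_def ..
  \<comment> \<open>The minimiser \<open>m\<close> only certifies existence; \<open>arg_minI\<close>
    transfers minimality to the point that \<open>ARG_MIN\<close> chooses.\<close>
  then have pmin: "J p \<le> J w" for w
    using arg_minI[of "\<lambda>_. True" m J "\<lambda>x. \<forall>w. J x \<le> J w"] min by (auto simp: not_less)
  have "J x0 < \<infinity>" by (simp add: J_def r0)
  then have "\<phi> p \<noteq> \<infinity>" using pmin[of x0] by (auto simp: J_def)
  then obtain rp where rp: "\<phi> p = ereal rp" using n[of p] by (cases "\<phi> p") auto
  show ?thesis
    unfolding subdifferential_def
  proof (intro CollectI allI)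
    fix y
    show "\<phi> p + ereal ((1 / \<gamma>) *\<^sub>R (v - p) \<bullet> (y - p)) \<le> \<phi> y"
    proof (cases "\<phi> y")
      case (real ry)
      \<comment> \<open>Moving from \<open>p\<close> by the fraction \<open>t\<close> towards
        \<open>y\<close> changes the quadratic term to first order in \<open>t\<close>, up to an
        error of order \<open>t\<close> squared. After division by \<open>t\<close> the error
        vanishes in the limit.\<close>
      have ineq: "rp + (1 / \<gamma>) * ((v - p) \<bullet> (y - p)) - ry \<le> t * ((norm (y - p))\<^sup>2 / (2 * \<gamma>))"
        if t: "0 < t" "t < 1" for t
      proof -
        let ?w = "(1 - t) *\<^sub>R p + t *\<^sub>R y"
        have "\<phi> ?w \<noteq> \<infinity>"
          using convexD[OF convex_on_imp_convex[OF convex_on_real_of_ereal[OF \<phi>]], of p y "1 - t" t] t rp real by simp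
        then obtain rw where rw: "\<phi> ?w = ereal rw" using n[of ?w] by (cases "\<phi> ?w") auto
        have "rw \<le> (1 - t) * rp + t * ry"
          using convex_onD[OF convex_on_real_of_ereal[OF \<phi>], of t p y] t rp real rw by simp
        moreover have "rp + q p \<le> rw + q ?w" using pmin[of ?w] by (simp add: J_def rp rw)
        moreover have "q ?w = q p - t * ((1 / \<gamma>) * ((v - p) \<bullet> (y - p))) + t * t * ((norm (y - p))\<^sup>2 / (2 * \<gamma>))"
        proof -
          have w: "?w - v = (p - v) + t *\<^sub>R (y - p)" by (simp add: algebra_simps)
          have "(norm (?w - v))\<^sup>2 = (norm (p - v))\<^sup>2 - 2 * t * ((v - p) \<bullet> (y - p)) + t * t * (norm (y - p))\<^sup>2"
            unfolding w power2_norm_eq_inner by (simp add: inner_simps inner_commute algebra_simps)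
          then show ?thesis unfolding q_def using \<gamma> by (simp add: field_simps)
        qed
        ultimately have "t * (rp + (1 / \<gamma>) * ((v - p) \<bullet> (y - p)) - ry) \<le> t * (t * ((norm (y - p))\<^sup>2 / (2 * \<gamma>)))"
          by (simp add: algebra_simps)
        then show ?thesis by (rule mult_left_le_imp_le) (use t in simp)
      qed
      have "((\<lambda>t. t * ((norm (y - p))\<^sup>2 / (2 * \<gamma>))) \<longlongrightarrow> 0 * ((norm (y - p))\<^sup>2 / (2 * \<gamma>))) (at_right 0)"
        by (intro tendsto_intros)
      moreover have "\<forall>\<^sub>F t in at_right 0. rp + (1 / \<gamma>) * ((v - p) \<bullet> (y - p)) - ry \<le> t * ((norm (y - p))\<^sup>2 / (2 * \<gamma>))"
        using eventually_at_right_less[of "0::real"] eventually_at_right_real[of 0 "1::real", simplified]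
        by eventually_elim (use ineq in auto)
      ultimately have "rp + (1 / \<gamma>) * ((v - p) \<bullet> (y - p)) - ry \<le> 0 * ((norm (y - p))\<^sup>2 / (2 * \<gamma>))"
        by (rule tendsto_lowerbound) simp
      then show ?thesis by (simp add: rp real)
    qed (use n in auto)
  qed
qed

section \<open>Smooth convex functions: tangents, descent and cocoercivity\<close>

lemma convex_gradient_le:
  fixes f :: "'a::euclidean_space \<Rightarrow> real"
  assumes f: "convex_on UNIV f" and df: "GDERIV f x :> d"
  shows "f x + d \<bullet> (y - x) \<le> f y"
proof -
  define \<phi> where "\<phi> t = f (x + t *\<^sub>R (y - x))" for t
  have 1: "(f has_derivative (\<lambda>v. v \<bullet> d)) (at (x + 0 *\<^sub>R (y - x)))" using df by (simp add: gderiv_def)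
  have 2: "((\<lambda>t. x + t *\<^sub>R (y - x)) has_derivative (\<lambda>t. t *\<^sub>R (y - x))) (at 0)"
    by (auto intro!: derivative_eq_intros)
  have "(\<phi> has_derivative (\<lambda>t. (t *\<^sub>R (y - x)) \<bullet> d)) (at 0)"
    unfolding \<phi>_def by (rule has_derivative_compose[OF 2 1])
  then have d0: "(\<phi> has_real_derivative (d \<bullet> (y - x))) (at 0)"
    by (simp add: has_field_derivative_def inner_commute mult_commute_abs)
  have "convex_on UNIV \<phi>"
  proof (rule convex_onI)
    fix t a b :: real assume t: "0 < t" "t < 1"
    have "x + ((1 - t) *\<^sub>R a + t *\<^sub>R b) *\<^sub>R (y - x) =
        (1 - t) *\<^sub>R (x + a *\<^sub>R (y - x)) + t *\<^sub>R (x + b *\<^sub>R (y - x))" by (simp add: algebra_simps)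
    then show "\<phi> ((1 - t) *\<^sub>R a + t *\<^sub>R b) \<le> (1 - t) * \<phi> a + t * \<phi> b"
      unfolding \<phi>_def using convex_onD[OF f, of t "x + a *\<^sub>R (y - x)" "x + b *\<^sub>R (y - x)"] t by simp
  qed simp
  then have "\<phi> 1 - \<phi> 0 \<ge> (d \<bullet> (y - x)) * (1 - 0)"
    using d0 by (intro convex_on_imp_above_tangent[of UNIV]) auto
  then show ?thesis by (simp add: \<phi>_def)
qed

text \<open>Along the segment, subtract the claimed quadratic bound from \<open>f\<close>; the
  Lipschitz estimate makes the derivative of the difference nonpositive.\<close>

lemma descent_lemma:
  fixes f :: "'a::euclidean_space \<Rightarrow> real"
  assumes df: "\<And>x. GDERIV f x :> df x" and lip: "L-lipschitz_on UNIV df"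
  shows "f y \<le> f x + df x \<bullet> (y - x) + L / 2 * (norm (y - x))\<^sup>2"
proof -
  let ?d = "y - x"
  define \<phi> where "\<phi> t = f (x + t *\<^sub>R ?d) - t * (df x \<bullet> ?d) - L / 2 * t\<^sup>2 * (norm ?d)\<^sup>2" for t
  have der: "(\<phi> has_real_derivative (df (x + t *\<^sub>R ?d) \<bullet> ?d - df x \<bullet> ?d - L * t * (norm ?d)\<^sup>2)) (at t)" for t
  proof -
    have 1: "(f has_derivative (\<lambda>v. v \<bullet> df (x + t *\<^sub>R ?d))) (at (x + t *\<^sub>R ?d))"
      using df by (simp add: gderiv_def)
    have 2: "((\<lambda>t. x + t *\<^sub>R ?d) has_derivative (\<lambda>t. t *\<^sub>R ?d)) (at t)"
      by (auto intro!: derivative_eq_intros)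
    have "((\<lambda>t. f (x + t *\<^sub>R ?d)) has_derivative (\<lambda>u. (u *\<^sub>R ?d) \<bullet> df (x + t *\<^sub>R ?d))) (at t)"
      by (rule has_derivative_compose[OF 2 1])
    then have "((\<lambda>t. f (x + t *\<^sub>R ?d)) has_real_derivative (df (x + t *\<^sub>R ?d) \<bullet> ?d)) (at t)"
      by (simp add: has_field_derivative_def inner_commute mult_commute_abs)
    then show ?thesis unfolding \<phi>_def
      by (auto intro!: derivative_eq_intros)
  qed
  have "\<phi> 1 \<le> \<phi> 0"
  proof (rule DERIV_nonpos_imp_nonincreasing[where f = \<phi> and a = 0 and b = 1])
    fix t :: real assume t: "0 \<le> t" "t \<le> 1"
    have "norm (df (x + t *\<^sub>R ?d) - df x) \<le> L * (t * norm ?d)"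
      using lipschitz_onD[OF lip, of "x + t *\<^sub>R ?d" x] t by (simp add: dist_norm)
    then have "(df (x + t *\<^sub>R ?d) - df x) \<bullet> ?d \<le> L * (t * norm ?d) * norm ?d"
      by (intro order_trans[OF norm_cauchy_schwarz] mult_right_mono) auto
    then have "df (x + t *\<^sub>R ?d) \<bullet> ?d - df x \<bullet> ?d - L * t * (norm ?d)\<^sup>2 \<le> 0"
      by (simp add: inner_diff_left power2_eq_square algebra_simps)
    then show "\<exists>d. (\<phi> has_real_derivative d) (at t) \<and> d \<le> 0" using der by blast
  qed simp
  then show ?thesis by (simp add: \<phi>_def)
qed

text \<open>The tangent inequality is sharpened by a squared gradient difference with factor 1/(2L);
  adding this sharpened form with the two points exchanged cancels the function values.\<close>

lemma convex_gradient_cocoercive: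
  fixes f :: "'a::euclidean_space \<Rightarrow> real"
  assumes f: "convex_on UNIV f" and df: "\<And>x. GDERIV f x :> df x"
    and lip: "L-lipschitz_on UNIV df" and L: "L > 0"
  shows "(norm (df y - df x))\<^sup>2 / L \<le> (df y - df x) \<bullet> (y - x)"
proof -
  have *: "f a + df a \<bullet> (b - a) + (norm (df b - df a))\<^sup>2 / (2 * L) \<le> f b" for a b
  proof -
    define e where "e = df b - df a"
    \<comment> \<open>A gradient step of length 1/L from \<open>b\<close> for \<open>f\<close> minus
      its linear part at \<open>a\<close>: it minimises the quadratic upper bound supplied by the
      descent lemma.\<close>
    define z where "z = b - (1 / L) *\<^sub>R e"
    have 1: "f a + df a \<bullet> (z - a) \<le> f z" by (rule convex_gradient_le[OF f df])
    have 2: "f z \<le> f b + df b \<bullet> (z - b) + L / 2 * (norm (z - b))\<^sup>2" by (rule descent_lemma[OF df lip])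
    have 3: "L / 2 * (norm (z - b))\<^sup>2 = (norm e)\<^sup>2 / (2 * L)"
      using L by (simp add: z_def power_divide power2_eq_square field_simps)
    have "df b \<bullet> (z - b) - df a \<bullet> (z - a) = - df a \<bullet> (b - a) - (1 / L) * (e \<bullet> e)"
      by (simp add: z_def e_def inner_simps inner_commute algebra_simps)
    with 1 2 3 have "f a + df a \<bullet> (b - a) + (1 / L) * (norm e)\<^sup>2 - (norm e)\<^sup>2 / (2 * L) \<le> f b"
      by (simp add: power2_norm_eq_inner)
    moreover have "(1 / L) * (norm e)\<^sup>2 - (norm e)\<^sup>2 / (2 * L) = (norm e)\<^sup>2 / (2 * L)" using L by (simp add: field_simps)
    ultimately show ?thesis by (simp add: e_def)
  qed
  have "(norm (df y - df x))\<^sup>2 / (2 * L) + (norm (df y - df x))\<^sup>2 / (2 * L) \<le> (df y - df x) \<bullet> (y - x)"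
    using *[of x y] *[of y x] by (simp add: inner_simps norm_minus_commute)
  then show ?thesis by (simp add: field_simps)
qed

section \<open>Quadratic estimates and averages\<close>

lemma young_inner:
  fixes v w :: "'a::real_inner"
  assumes c: "c > 0"
  shows "v \<bullet> w \<le> (c * (norm v)\<^sup>2 + (norm w)\<^sup>2 / c) / 2"
proof -
  have "0 \<le> (norm (c *\<^sub>R v - w))\<^sup>2 / c" using c by simp
  also have "\<dots> = c * (norm v)\<^sup>2 + (norm w)\<^sup>2 / c - 2 * (v \<bullet> w)"
    using c unfolding power2_norm_eq_inner
    by (simp add: inner_simps inner_commute field_simps)
  finally show ?thesis by simp
qed

lemma norm_add_sq_le:
  fixes v w :: "'a::real_inner"
  shows "(norm (v + w))\<^sup>2 \<le> 2 * (norm v)\<^sup>2 + 2 * (norm w)\<^sup>2"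
  using young_inner[of 1 v w] by (simp add: power2_norm_eq_inner inner_simps inner_commute)

lemma norm_diff_sq_le:
  fixes v w :: "'a::real_inner"
  shows "(norm (v - w))\<^sup>2 \<le> 2 * (norm v)\<^sup>2 + 2 * (norm w)\<^sup>2"
  using norm_add_sq_le[of v "- w"] by simp

lemma quadratic_form_coercive:
  fixes a b m :: real
  assumes "a > 0" "b > 0" "m\<^sup>2 < 4 * a * b"
  obtains c where "c > 0"
    "\<And>v w :: 'a::real_inner. c * ((norm v)\<^sup>2 + (norm w)\<^sup>2) \<le> a * (norm v)\<^sup>2 + b * (norm w)\<^sup>2 + m * (v \<bullet> w)"
proof -
  \<comment> \<open>With this choice (a - c)(b - c) equals m^2/4 + c^2, so the form keeps a
    nonpositive discriminant after \<open>c\<close> is subtracted from both diagonal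
    coefficients.\<close>
  define c where "c = (4 * a * b - m\<^sup>2) / (4 * (a + b))"
  have c: "c > 0" using assms by (simp add: c_def)
  have "4 * a * b - m\<^sup>2 < a * (4 * (a + b))" 
  proof -
    have "a * (4 * (a + b)) = 4 * a * b + 4 * (a * a)" by (simp add: algebra_simps)
    then show ?thesis using mult_pos_pos[OF assms(1) assms(1)] zero_le_power2[of m] by linarith
  qed
  then have ca: "c < a" unfolding c_def using assms by (simp add: divide_less_eq)
  have "c * (a + b) = a * b - m\<^sup>2 / 4" using assms by (simp add: c_def field_simps)
  moreover have "(a - c) * (b - c) = a * b - c * (a + b) + c * c" by (simp add: algebra_simps)
  ultimately have "m\<^sup>2 / 4 \<le> (a - c) * (b - c)" using zero_le_square[of c] by argo
  then have bc: "m\<^sup>2 / (4 * (a - c)) \<le> b - c" using ca by (simp add: field_simps)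
  show ?thesis
  proof (rule that[OF c])
    fix v w :: 'a
    have "v \<bullet> (- (m *\<^sub>R w)) \<le> (2 * (a - c) * (norm v)\<^sup>2 + (norm (- (m *\<^sub>R w)))\<^sup>2 / (2 * (a - c))) / 2"
      using ca by (intro young_inner) simp
    also have "\<dots> = (a - c) * (norm v)\<^sup>2 + m\<^sup>2 / (4 * (a - c)) * (norm w)\<^sup>2"
      using ca by (simp add: power_mult_distrib field_simps)
    also have "\<dots> \<le> (a - c) * (norm v)\<^sup>2 + (b - c) * (norm w)\<^sup>2"
      using bc by (intro add_left_mono mult_right_mono) auto
    finally show "c * ((norm v)\<^sup>2 + (norm w)\<^sup>2) \<le> a * (norm v)\<^sup>2 + b * (norm w)\<^sup>2 + m * (v \<bullet> w)"
      by (simp add: algebra_simps)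
  qed
qed

text \<open>Two telescoping sums. \<open>W\<close> is meant for the saddle point and bounds the
  accumulated errors \<open>e\<close>; \<open>V\<close> is meant for an arbitrary test pair, where
  the errors enter with the wrong sign and \<open>V\<close> need only be bounded below.\<close>

lemma sum_bound_of_lyapunov:
  fixes W e V t :: "nat \<Rightarrow> real"
  assumes W: "\<And>k. W (Suc k) \<le> W k - c * e k" "\<And>k. 0 \<le> W k" and c: "0 < c" and M: "0 \<le> M"
    and t: "\<And>k. t k \<le> V k - V (Suc k) + M * e k" and V: "\<And>k. - m \<le> V k"
  shows "\<exists>C. \<forall>K. (\<Sum>k<K. t k) \<le> C"
proof -
  have e: "c * (\<Sum>k<K. e k) \<le> W 0 - W K" for K
  proof (induction K)
    case (Suc K)
    then show ?case using W(1)[of K] by (simp add: algebra_simps)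
  qed simp
  have "(\<Sum>k<K. t k) \<le> V 0 - V K + M * (\<Sum>k<K. e k)" for K
  proof (induction K)
    case (Suc K)
    then show ?case using t[of K] by (simp add: algebra_simps)
  qed simp
  moreover have "(\<Sum>k<K. e k) \<le> W 0 / c" for K
    using e[of K] W(2)[of K] c by (simp add: field_simps)
  ultimately have "(\<Sum>k<K. t k) \<le> V 0 + m + M * (W 0 / c)" for K
    using V[of K] mult_left_mono[OF \<open>\<And>K. (\<Sum>k<K. e k) \<le> W 0 / c\<close>[of K] M]
    by (smt (verit))
  then show ?thesis by blast
qed

text \<open>The bound on \<open>\<beta>\<close> is the larger root of \<alpha>(2 - \<beta>)^2 = 4 -
  3\<beta>. For \<beta> > 1 the choice \<theta> = 1/\<beta> turns the last required inequality,
  multiplied by \<beta>^2, into the strict form of this relation. In the PDDY analysis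
  \<open>\<theta>\<close> is the share of the dual quadratic form that remains nonnegative, and the
  last inequality is the room left in the Lyapunov estimate.\<close>

lemma pddy_stepsize:
  fixes \<alpha> \<beta> :: real
  assumes a: "0 < \<alpha>" "\<alpha> < 1" and b: "\<beta> < (4 * \<alpha> - 3 + sqrt (9 - 8 * \<alpha>)) / (2 * \<alpha>)"
  obtains \<theta> where "1 / 2 < \<theta>" "\<theta> \<le> 1" "\<theta> * \<beta> \<le> 1" "1 - \<theta> < (2 * \<theta> - 1)\<^sup>2 * (1 - \<alpha>)"
proof (cases "\<beta> \<le> 1")
  case True
  then show ?thesis using a by (intro that[of 1]) auto
next
  case False
  then have b1: "1 < \<beta>" by simp
  have lt: "2 * \<alpha> * \<beta> - 4 * \<alpha> + 3 < sqrt (9 - 8 * \<alpha>)"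
    using b a by (simp add: field_simps)
  have "\<alpha> * 1 < \<alpha> * \<beta>" using a b1 by (intro mult_strict_left_mono) auto
  then have "0 \<le> 2 * \<alpha> * \<beta> - 4 * \<alpha> + 3" using a by linarith
  then have "(2 * \<alpha> * \<beta> - 4 * \<alpha> + 3)\<^sup>2 < (sqrt (9 - 8 * \<alpha>))\<^sup>2"
    using lt by (intro power_strict_mono) auto
  also have "\<dots> = 9 - 8 * \<alpha>" using a by simp
  \<comment> \<open>Squaring is legitimate because \<beta> > 1 makes the left side nonnegative; the
    constant 9 cancels and a factor 4\<alpha> splits off.\<close>
  finally have "4 * \<alpha> * (\<alpha> * (2 - \<beta>)\<^sup>2) < 4 * \<alpha> * (4 - 3 * \<beta>)"
    by (simp add: power2_eq_square algebra_simps)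
  then have key: "\<alpha> * (2 - \<beta>)\<^sup>2 < 4 - 3 * \<beta>" using a by simp
  moreover have "0 \<le> \<alpha> * (2 - \<beta>)\<^sup>2" using a by simp
  ultimately have b2: "\<beta> < 2" by linarith
  have "\<beta> * (\<beta> - 1) < (2 - \<beta>)\<^sup>2 * (1 - \<alpha>)"
    using key by (simp add: power2_eq_square algebra_simps)
  then have "\<beta> * (\<beta> - 1) / \<beta>\<^sup>2 < (2 - \<beta>)\<^sup>2 * (1 - \<alpha>) / \<beta>\<^sup>2"
    using b1 by (intro divide_strict_right_mono) auto
  moreover have "\<beta> * (\<beta> - 1) / \<beta>\<^sup>2 = 1 - 1 / \<beta>" using b1 by (simp add: power2_eq_square field_simps)
  moreover have "(2 * (1 / \<beta>) - 1)\<^sup>2 = (2 - \<beta>)\<^sup>2 / \<beta>\<^sup>2"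
    using b1 by (simp add: field_simps flip: power_divide)
  ultimately have "1 - 1 / \<beta> < (2 * (1 / \<beta>) - 1)\<^sup>2 * (1 - \<alpha>)" by simp
  then show ?thesis using b1 b2 by (intro that[of "1 / \<beta>"]) (auto simp: divide_less_eq less_divide_eq)
qed

section \<open>Jensen's inequality for averages and the sign of the gap\<close>

lemma convex_on_ergodic_average:
  assumes F: "convex_on S F" and v: "\<And>k. v k \<in> S" and K: "K \<ge> 1"
  shows "ergodic_average v K \<in> S" "F (ergodic_average v K) \<le> (\<Sum>k<K. F (v k)) / real K"
proof -
  have av: "ergodic_average v K = (\<Sum>k<K. (1 / real K) *\<^sub>R v k)"
    by (simp add: ergodic_average_def scaleR_sum_right)
  have "0 \<in> {..<K}" using K by simp
  then have ne: "{..<K} \<noteq> {}" by blast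
  have one: "(\<Sum>k<K. 1 / real K) = 1" using K by simp
  show "ergodic_average v K \<in> S"
    unfolding av using one v by (intro convex_sum convex_on_imp_convex[OF F]) auto
  have "F (\<Sum>k<K. (1 / real K) *\<^sub>R v k) \<le> (\<Sum>k<K. (1 / real K) * F (v k))"
    using one v K by (intro convex_on_sum[OF _ ne F]) auto
  then show "F (ergodic_average v K) \<le> (\<Sum>k<K. F (v k)) / real K"
    by (simp add: av sum_divide_distrib)
qed

lemma saddle_point_gap_nonneg:
  fixes F :: "'a \<Rightarrow> 'b \<Rightarrow> ereal"
  assumes "saddle_point F xs ss" "\<bar>F xs ss\<bar> \<noteq> \<infinity>"
  shows "0 \<le> F x ss - F xs y"
proof -
  have "F xs y \<le> F xs ss" "F xs ss \<le> F x ss" using assms by (auto simp: saddle_point_def)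
  then show ?thesis using assms(2)
    by (cases "F xs ss"; cases "F xs y"; cases "F x ss") auto
qed

section \<open>Saddle problems\<close>

text \<open>The saddle point enters through its optimality system, the form needed for subgradient
  inequalities. It is the reference at which residuals are shown to be summable; test pairs stay
  arbitrary.\<close>

locale saddle_problem =
  fixes f :: "'a::euclidean_space \<Rightarrow> real" and df :: "'a \<Rightarrow> 'a" and g :: "'a \<Rightarrow> ereal"
    and h :: "'b::euclidean_space \<Rightarrow> ereal" and A :: "'a \<Rightarrow> 'b"
    and L \<tau> \<eta> \<alpha> \<beta> :: real and xs :: 'a and ss :: 'b
  assumes f_convex: "convex_on UNIV f"
    and f_gradient: "\<And>x. GDERIV f x :> df x"
    and L_pos: "L > 0"
    and df_lipschitz: "L-lipschitz_on UNIV df"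
    and g: "proper_closed_convex g"
    and h: "proper_closed_convex h"
    and A: "linear A"
    and tau: "\<tau> > 0" and eta: "\<eta> > 0"
    and alpha: "\<alpha> = \<tau> * L / 2"
    and beta: "\<beta> = \<tau> * \<eta> * (onorm A)\<^sup>2"
    and opt_x: "- df xs - adjoint A ss \<in> subdifferential g xs"
    and opt_s: "A xs \<in> subdifferential (conjugate h) ss"
begin

abbreviation At :: "'b \<Rightarrow> 'a" where "At \<equiv> adjoint A"
abbreviation G :: "'a \<Rightarrow> real" where "G x \<equiv> real_of_ereal (g x)"
abbreviation H :: "'b \<Rightarrow> real" where "H y \<equiv> real_of_ereal (conjugate h y)"

lemma hc: "proper_closed_convex (conjugate h)"
  by (rule proper_closed_convex_conjugate[OF h])

lemma proper_g: "proper_fun g" and proper_hc: "proper_fun (conjugate h)"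
  using g hc by (auto simp: proper_closed_convex_def)

section \<open>Adjoint calculus and norm bounds\<close>

lemma alpha_pos: "0 < \<alpha>" unfolding alpha using tau L_pos by simp

lemma At_linear: "linear At" by (rule adjoint_linear[OF A])

lemma A_inner: "A v \<bullet> w = v \<bullet> At w"
  by (simp add: adjoint_works[OF A])

lemma inner_A: "w \<bullet> A v = v \<bullet> At w"
  by (simp add: A_inner inner_commute[of w])

lemmas A_simps = A_inner inner_A linear_add[OF At_linear] linear_diff[OF At_linear] linear_scale[OF At_linear]
  linear_neg[OF At_linear]

lemma norm_A_le: "norm (A v) \<le> onorm A * norm v"
  using A by (simp add: onorm linear_conv_bounded_linear)

lemma norm_A_sq: "\<eta> * (norm (A v))\<^sup>2 \<le> \<beta> / \<tau> * (norm v)\<^sup>2"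
proof -
  have "(norm (A v))\<^sup>2 \<le> (onorm A * norm v)\<^sup>2" by (rule power_mono[OF norm_A_le]) simp
  then have "\<eta> * (norm (A v))\<^sup>2 \<le> \<eta> * (onorm A * norm v)\<^sup>2" using eta by simp
  also have "\<dots> = \<beta> / \<tau> * (norm v)\<^sup>2" using tau by (simp add: beta power_mult_distrib)
  finally show ?thesis .
qed

text \<open>The adjoint inherits the operator norm bound: the square of |At w| is the inner product
  of \<open>A (At w)\<close> with \<open>w\<close>, and one factor |At w| cancels.\<close>

lemma norm_At_sq: "\<tau> * (norm (At w))\<^sup>2 \<le> \<beta> / \<eta> * (norm w)\<^sup>2"
proof -
  have o: "0 \<le> onorm A" using A by (simp add: onorm_pos_le linear_conv_bounded_linear)
  have "norm (At w) * norm (At w) = A (At w) \<bullet> w" by (simp add: A_inner flip: power2_norm_eq_inner power2_eq_square)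
  also have "\<dots> \<le> norm (A (At w)) * norm w" by (rule norm_cauchy_schwarz)
  also have "\<dots> \<le> (onorm A * norm (At w)) * norm w" by (intro mult_right_mono norm_A_le) simp
  finally have "norm (At w) * norm (At w) \<le> (onorm A * norm w) * norm (At w)" by (simp add: mult_ac)
  then have "norm (At w) \<le> onorm A * norm w"
    using o by (cases "norm (At w) = 0") (auto simp: mult_le_cancel_right)
  then have "(norm (At w))\<^sup>2 \<le> (onorm A * norm w)\<^sup>2" by (rule power_mono) simp
  then have "\<tau> * (norm (At w))\<^sup>2 \<le> \<tau> * (onorm A * norm w)\<^sup>2" using tau by simp
  also have "\<dots> = \<beta> / \<eta> * (norm w)\<^sup>2" using eta by (simp add: beta power_mult_distrib)
  finally show ?thesis .
qed

text \<open>Writing the prox argument as the output plus \<open>\<tau> *\<^sub>R v\<close> exhibits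
  the subgradient hidden in an implicit step; every algorithm below is first brought into this
  form.\<close>

lemma prox_g:
  assumes "p = prox \<tau> g (p + \<tau> *\<^sub>R v)"
  shows "v \<in> subdifferential g p"
  using prox_subdifferential[OF g tau assms] tau by simp

lemma prox_h:
  assumes "p = prox \<eta> (conjugate h) (p + \<eta> *\<^sub>R v)"
  shows "v \<in> subdifferential (conjugate h) p"
  using prox_subdifferential[OF hc eta assms] eta by simp

section \<open>One-step bounds for the gap\<close>

text \<open>The part of the primal-dual gap \<open>\<L>(u, y) - \<L>(x, v)\<close> that does not involve \<open>f\<close>.\<close>

definition nonsmooth_gap :: "'a \<Rightarrow> 'b \<Rightarrow> 'a \<Rightarrow> 'b \<Rightarrow> real" where
  "nonsmooth_gap x y u v = G u - G x + A u \<bullet> y - A x \<bullet> v + H v - H y"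

text \<open>The sum of the two subgradient inequalities at the outputs. For each algorithm the right
  side is then rewritten as a telescoping difference plus quadratic residuals.\<close>

lemma nonsmooth_gap_le:
  assumes "g x \<noteq> \<infinity>" "conjugate h y \<noteq> \<infinity>"
    and "p \<in> subdifferential g u" "q \<in> subdifferential (conjugate h) v"
  shows "nonsmooth_gap x y u v \<le> p \<bullet> (u - x) + q \<bullet> (v - y) + u \<bullet> At y - x \<bullet> At v"
  using subdifferential_real(2)[OF proper_g assms(3) assms(1)]
    subdifferential_real(2)[OF proper_hc assms(4) assms(2)]
  unfolding nonsmooth_gap_def A_inner by (simp add: inner_diff_right)

text \<open>Thus the gap at the saddle point is nonnegative even with \<open>f\<close> replaced by
  its linearisation at \<open>xs\<close>, which lies below \<open>f\<close>. This stronger form lets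
  cocoercivity be used in full.\<close>

lemma nonsmooth_gap_saddle:
  assumes "g u \<noteq> \<infinity>" "conjugate h v \<noteq> \<infinity>"
  shows "- (df xs \<bullet> (u - xs)) \<le> nonsmooth_gap xs ss u v"
  using subdifferential_real(2)[OF proper_g opt_x assms(1)]
    subdifferential_real(2)[OF proper_hc opt_s assms(2)]
  unfolding nonsmooth_gap_def by (simp add: A_simps inner_simps inner_commute[of "At ss"])

lemma saddle_finite: "g xs \<noteq> \<infinity>" "conjugate h ss \<noteq> \<infinity>"
  using subdifferential_real(1)[OF proper_g opt_x] subdifferential_real(1)[OF proper_hc opt_s] by auto

text \<open>The gradient is taken at a third point \<open>y\<close>: descend from \<open>y\<close>
  to \<open>u\<close> and use the tangent from \<open>y\<close> to \<open>x\<close>.\<close>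

lemma smooth_gap_le: "f u - f x \<le> df y \<bullet> (u - x) + L / 2 * (norm (u - y))\<^sup>2"
  using descent_lemma[OF f_gradient df_lipschitz, of u y] convex_gradient_le[OF f_convex f_gradient, of y x]
  by (simp add: inner_diff_right)

lemma cocoercive: "(norm (df y - df xs))\<^sup>2 / L \<le> (df y - df xs) \<bullet> (y - xs)"
  by (rule convex_gradient_cocoercive[OF f_convex f_gradient df_lipschitz L_pos])

text \<open>The Young weight 2/L makes the squared gradient difference cancel against cocoercivity.
  What remains has factor L/4, half of the L/2 in \<open>smooth_gap_le\<close>; this is the gain
  available only at the saddle point.\<close>

lemma cocoercive_shifted: "df xs \<bullet> (u - xs) \<le> df y \<bullet> (u - xs) + L / 4 * (norm (u - y))\<^sup>2"
proof -
  have "(df xs - df y) \<bullet> (u - y) \<le> (2 / L * (norm (df xs - df y))\<^sup>2 + (norm (u - y))\<^sup>2 / (2 / L)) / 2"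
    using L_pos by (intro young_inner) simp
  then show ?thesis
    using cocoercive[of y] by (simp add: norm_minus_commute inner_simps inner_commute field_simps)
qed

text \<open>The common target of the four analyses. Finiteness of the outputs makes the real-valued
  gap meaningful; test pairs outside the domains are treated separately, where the extended-real gap
  is minus infinity.\<close>

definition bounded_gap_sums :: "(nat \<Rightarrow> 'a) \<Rightarrow> (nat \<Rightarrow> 'b) \<Rightarrow> bool" where
  "bounded_gap_sums u s \<longleftrightarrow> (\<forall>k. g (u k) \<noteq> \<infinity> \<and> conjugate h (s (Suc k)) \<noteq> \<infinity>) \<and>
     (\<forall>x y. g x \<noteq> \<infinity> \<longrightarrow> conjugate h y \<noteq> \<infinity> \<longrightarrow>
       (\<exists>C. \<forall>K. (\<Sum>k<K. f (u k) - f x + nonsmooth_gap x y (u k) (s (Suc k))) \<le> C))"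

subsection \<open>Condat--Vu\<close>

lemma condat_vu_bounded_gap_sums:
  assumes run: "condat_vu \<tau> \<eta> df g h A x s" and cond: "\<alpha> + \<beta> < 1"
  shows "bounded_gap_sums (\<lambda>k. x (Suc k)) s"
proof -
  have subG: "(1 / \<tau>) *\<^sub>R (x k - x (Suc k)) - df (x k) - At (s k) \<in> subdifferential g (x (Suc k))" for k
    using run tau by (intro prox_g) (simp add: condat_vu_def algebra_simps)
  have subH: "(1 / \<eta>) *\<^sub>R (s k - s (Suc k)) + A (2 *\<^sub>R x (Suc k) - x k)
      \<in> subdifferential (conjugate h) (s (Suc k))" for k
    using run eta by (intro prox_h) (simp add: condat_vu_def algebra_simps)
  have fin: "g (x (Suc k)) \<noteq> \<infinity>" "conjugate h (s (Suc k)) \<noteq> \<infinity>" for k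
    using subdifferential_real(1)[OF proper_g subG] subdifferential_real(1)[OF proper_hc subH] by auto
  \<comment> \<open>Half the squared length of \<open>(v, w)\<close> in the metric with diagonal
    blocks I/\<tau>, I/\<eta> and off-diagonal blocks -At, -A, in which Condat--Vu is a
    forward-backward step. The bound \<open>step\<close> is its three-point identity.\<close>
  define P where "P v w = ((norm v)\<^sup>2 / \<tau> + (norm w)\<^sup>2 / \<eta>) / 2 - v \<bullet> At w" for v w
  have P_ge: "(1 - \<beta>) / (2 * \<tau>) * (norm v)\<^sup>2 \<le> P v w" for v w
  proof -
    have "v \<bullet> At w \<le> (\<eta> * (norm (A v))\<^sup>2 + (norm w)\<^sup>2 / \<eta>) / 2"
      using young_inner[OF eta, of "A v" w] by (simp add: A_inner)
    also have "\<dots> \<le> (\<beta> / \<tau> * (norm v)\<^sup>2 + (norm w)\<^sup>2 / \<eta>) / 2" using norm_A_sq[of v] by (intro divide_right_mono add_right_mono) auto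
    finally have "P v w \<ge> ((norm v)\<^sup>2 / \<tau> - \<beta> / \<tau> * (norm v)\<^sup>2) / 2"
      unfolding P_def by argo
    then show ?thesis using tau by (simp add: field_simps)
  qed
  have "0 \<le> (1 - \<beta>) / (2 * \<tau>) * (norm v)\<^sup>2" for v :: 'a using cond alpha_pos tau by simp
  then have P_nonneg: "0 \<le> P v w" for v w using P_ge order_trans by blast
  have step: "nonsmooth_gap x' y' (x (Suc k)) (s (Suc k)) \<le> - (df (x k) \<bullet> (x (Suc k) - x'))
      + P (x k - x') (s k - y') - P (x (Suc k) - x') (s (Suc k) - y') - P (x (Suc k) - x k) (s (Suc k) - s k)"
    if "g x' \<noteq> \<infinity>" "conjugate h y' \<noteq> \<infinity>" for x' y' k
    using nonsmooth_gap_le[OF that subG[of k] subH[of k]] tau eta unfolding P_def power2_norm_eq_inner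
    by (simp add: A_simps inner_simps inner_commute diff_divide_distrib add_divide_distrib algebra_simps)
  define e where "e k = (norm (x (Suc k) - x k))\<^sup>2" for k
  show ?thesis unfolding bounded_gap_sums_def
  proof (intro conjI allI impI fin)
    fix x' y' assume dom: "g x' \<noteq> \<infinity>" "conjugate h y' \<noteq> \<infinity>"
    show "\<exists>C. \<forall>K. (\<Sum>k<K. f (x (Suc k)) - f x' + nonsmooth_gap x' y' (x (Suc k)) (s (Suc k))) \<le> C"
    proof (rule sum_bound_of_lyapunov)
      fix k
      \<comment> \<open>The metric offers (1 - \<beta>)/(2\<tau>) and linearisation costs L/4 =
        \<alpha>/(2\<tau>); the surplus is positive because \<alpha> + \<beta> < 1.\<close>
      have "(1 - \<alpha> - \<beta>) / (2 * \<tau>) * e k = (1 - \<beta>) / (2 * \<tau>) * e k - L / 4 * e k"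
        using tau by (simp add: alpha field_simps)
      then show "P (x (Suc k) - xs) (s (Suc k) - ss) \<le> P (x k - xs) (s k - ss) - (1 - \<alpha> - \<beta>) / (2 * \<tau>) * e k"
        using step[OF saddle_finite, of k] nonsmooth_gap_saddle[OF fin, of k k] P_ge[of "x (Suc k) - x k" "s (Suc k) - s k"]
          cocoercive_shifted[of "x (Suc k)" "x k"] unfolding e_def by linarith
      show "f (x (Suc k)) - f x' + nonsmooth_gap x' y' (x (Suc k)) (s (Suc k))
        \<le> P (x k - x') (s k - y') - P (x (Suc k) - x') (s (Suc k) - y') + L / 2 * e k"
        using step[OF dom, of k] smooth_gap_le[of "x (Suc k)" x' "x k"] P_nonneg[of "x (Suc k) - x k" "s (Suc k) - s k"]
        unfolding e_def by linarith
      show "- 0 \<le> P (x k - x') (s k - y')" using P_nonneg by simp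
    qed (use P_nonneg cond tau L_pos in auto)
  qed
qed

subsection \<open>PD3O\<close>

lemma pd3o_bounded_gap_sums:
  assumes run: "pd3o \<tau> \<eta> df g h A x z s" and a1: "\<alpha> < 1" and b1: "\<beta> \<le> 1"
  shows "bounded_gap_sums x s"
proof -
  have z_Suc: "z (Suc k) = x k - \<tau> *\<^sub>R df (x k) - \<tau> *\<^sub>R At (s (Suc k))" for k
    using run by (simp add: pd3o_def)
  have subG: "(1 / \<tau>) *\<^sub>R (z k - x k) \<in> subdifferential g (x k)" for k
    using run tau by (intro prox_g) (simp add: pd3o_def)
  \<comment> \<open>Eliminating the gradient through \<open>z (Suc k)\<close> leaves only
    \<open>z\<close> differences and the correction \<tau> At (s (Suc k) - s k), which becomes the
    negative part of \<open>Q\<close>.\<close>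
  have subH: "(1 / \<eta>) *\<^sub>R (s k - s (Suc k)) + A (x k - z k + z (Suc k) + \<tau> *\<^sub>R At (s (Suc k) - s k))
      \<in> subdifferential (conjugate h) (s (Suc k))" for k
  proof (rule prox_h)
    have arg: "s k - (\<tau> * \<eta>) *\<^sub>R A (At (s k)) + \<eta> *\<^sub>R A (2 *\<^sub>R x k - z k - \<tau> *\<^sub>R df (x k)) =
      s (Suc k) + \<eta> *\<^sub>R ((1 / \<eta>) *\<^sub>R (s k - s (Suc k)) + A (x k - z k + z (Suc k) + \<tau> *\<^sub>R At (s (Suc k) - s k)))"
      using eta by (simp add: z_Suc scaleR_2 linear_add[OF A] linear_diff[OF A] linear_scale[OF A]
        linear_diff[OF At_linear] algebra_simps)
    have "s (Suc k) = prox \<eta> (conjugate h)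
        (s k - (\<tau> * \<eta>) *\<^sub>R A (At (s k)) + \<eta> *\<^sub>R A (2 *\<^sub>R x k - z k - \<tau> *\<^sub>R df (x k)))"
      using run unfolding pd3o_def by blast
    then show "s (Suc k) = prox \<eta> (conjugate h) (s (Suc k) + \<eta> *\<^sub>R ((1 / \<eta>) *\<^sub>R (s k - s (Suc k)) +
        A (x k - z k + z (Suc k) + \<tau> *\<^sub>R At (s (Suc k) - s k))))"
      by (simp only: arg)
  qed
  have fin: "g (x k) \<noteq> \<infinity>" "conjugate h (s (Suc k)) \<noteq> \<infinity>" for k
    using subdifferential_real(1)[OF proper_g subG] subdifferential_real(1)[OF proper_hc subH] by auto
  define Q where "Q w = (norm w)\<^sup>2 / \<eta> - \<tau> * (norm (At w))\<^sup>2" for w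
  have Q_nonneg: "0 \<le> Q w" for w
    using norm_At_sq[of w] mult_right_mono[OF b1, of "(norm w)\<^sup>2 / \<eta>"] eta by (simp add: Q_def)
  define d where "d k = df (x k) - df xs" for k
  define \<Delta> where "\<Delta> k = z k - z (Suc k)" for k
  \<comment> \<open>The value of \<open>z\<close> that would belong to the test pair if the gradient
    were frozen at \<open>xs\<close>; at the saddle point it is the limit equation for
    \<open>z\<close>. Centring here leaves the error \<Delta> k times \<open>d k\<close>, whose
    factors are both controlled at the saddle point.\<close>
  define c where "c x' y' = x' - \<tau> *\<^sub>R df xs - \<tau> *\<^sub>R At y'" for x' y'
  define V where "V x' y' k = (norm (z k - c x' y'))\<^sup>2 / (2 * \<tau>) + Q (s k - y') / 2" for x' y' k
  have V_nonneg: "0 \<le> V x' y' k" for x' y' k using Q_nonneg tau by (simp add: V_def)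
  have step: "nonsmooth_gap x' y' (x k) (s (Suc k)) \<le> - (df (x k) \<bullet> (x k - x')) + V x' y' k - V x' y' (Suc k)
      - (norm (\<Delta> k))\<^sup>2 / (2 * \<tau>) - Q (s k - s (Suc k)) / 2 + \<Delta> k \<bullet> d k"
    if dom: "g x' \<noteq> \<infinity>" "conjugate h y' \<noteq> \<infinity>" for x' y' k
  proof -
    let ?s = "s (Suc k)" and ?z = "z (Suc k)"
    have x: "x k = ?z + \<tau> *\<^sub>R df (x k) + \<tau> *\<^sub>R At ?s" by (simp add: z_Suc)
    have 1: "V x' y' k - V x' y' (Suc k) - (norm (\<Delta> k))\<^sup>2 / (2 * \<tau>) - Q (s k - ?s) / 2 =
        (1 / \<tau>) * (\<Delta> k \<bullet> (?z - c x' y')) + (1 / \<eta>) * ((s k - ?s) \<bullet> (?s - y'))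
          - \<tau> * (At (s k - ?s) \<bullet> At (?s - y'))"
      using tau eta unfolding V_def Q_def \<Delta>_def power2_norm_eq_inner
      by (simp add: A_simps inner_simps inner_commute diff_divide_distrib add_divide_distrib algebra_simps)
    have 2: "?z - c x' y' + \<tau> *\<^sub>R d k = x k - x' - \<tau> *\<^sub>R At (?s - y')"
      by (simp add: z_Suc c_def d_def algebra_simps linear_diff[OF At_linear])
    have 3: "(1 / \<tau>) * (\<Delta> k \<bullet> (?z - c x' y')) + \<Delta> k \<bullet> d k = (1 / \<tau>) * (\<Delta> k \<bullet> (?z - c x' y' + \<tau> *\<^sub>R d k))"
      using tau by (simp add: inner_simps field_simps)
    have 4: "(1 / \<tau>) *\<^sub>R \<Delta> k = (1 / \<tau>) *\<^sub>R (z k - x k) + df (x k) + At ?s"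
      using tau by (simp add: \<Delta>_def z_Suc algebra_simps)
    have "(1 / \<tau>) * (\<Delta> k \<bullet> (x k - x' - \<tau> *\<^sub>R At (?s - y'))) =
        ((1 / \<tau>) *\<^sub>R \<Delta> k) \<bullet> (x k - x') - \<Delta> k \<bullet> At (?s - y')"
      using tau by (simp add: inner_simps field_simps)
    also have "\<dots> = ((1 / \<tau>) *\<^sub>R (z k - x k) + df (x k) + At ?s) \<bullet> (x k - x') - \<Delta> k \<bullet> At (?s - y')"
      unfolding 4 ..
    finally show ?thesis
      using nonsmooth_gap_le[OF dom subG[of k] subH[of k]] 1 3 unfolding 2
      by (simp add: \<Delta>_def A_simps inner_simps inner_commute algebra_simps)
  qed
  \<comment> \<open>The product condition for the form in \<open>\<Delta> k\<close> and
    \<open>d k\<close>, the latter weighted by 1/L from cocoercivity; it amounts to \<alpha> <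
    1.\<close>
  have "4 * (1 / (2 * \<tau>)) * (1 / L) > (- 1)\<^sup>2"
    using a1 tau L_pos by (simp add: alpha field_simps)
  then obtain \<kappa> where \<kappa>: "\<kappa> > 0" "\<And>v w :: 'a. \<kappa> * ((norm v)\<^sup>2 + (norm w)\<^sup>2) \<le>
      1 / (2 * \<tau>) * (norm v)\<^sup>2 + 1 / L * (norm w)\<^sup>2 + (- 1) * (v \<bullet> w)"
    using quadratic_form_coercive[where ?'a = 'a, of "1 / (2 * \<tau>)" "1 / L" "- 1"] tau L_pos by auto
  define e where "e k = (norm (\<Delta> k))\<^sup>2 + (norm (d k))\<^sup>2" for k
  show ?thesis unfolding bounded_gap_sums_def
  proof (intro conjI allI impI fin)
    fix x' y' assume dom: "g x' \<noteq> \<infinity>" "conjugate h y' \<noteq> \<infinity>"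
    show "\<exists>C. \<forall>K. (\<Sum>k<K. f (x k) - f x' + nonsmooth_gap x' y' (x k) (s (Suc k))) \<le> C"
    proof (rule sum_bound_of_lyapunov)
      fix k
      have "df xs \<bullet> (x k - xs) \<le> df (x k) \<bullet> (x k - xs) - (norm (d k))\<^sup>2 / L"
        using cocoercive[of "x k"] by (simp add: d_def inner_diff_left)
      then show "V xs ss (Suc k) \<le> V xs ss k - \<kappa> * e k"
        using step[OF saddle_finite, of k] nonsmooth_gap_saddle[OF fin, of k k] \<kappa>(2)[of "\<Delta> k" "d k"]
          Q_nonneg[of "s k - s (Suc k)"] unfolding e_def by (simp add: algebra_simps)
      have "\<Delta> k \<bullet> d k \<le> 1 / 2 * e k" using young_inner[of 1 "\<Delta> k" "d k"] by (simp add: e_def)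
      moreover have "0 \<le> (norm (\<Delta> k))\<^sup>2 / (2 * \<tau>)" using tau by simp
      \<comment> \<open>The gradient is evaluated at the output itself, so the quadratic term of
        \<open>smooth_gap_le\<close> vanishes.\<close>
      moreover have "f (x k) - f x' \<le> df (x k) \<bullet> (x k - x')" using smooth_gap_le[of "x k" x' "x k"] by simp
      ultimately show "f (x k) - f x' + nonsmooth_gap x' y' (x k) (s (Suc k))
        \<le> V x' y' k - V x' y' (Suc k) + 1 / 2 * e k"
        using step[OF dom, of k] Q_nonneg[of "s k - s (Suc k)"] by linarith
      show "- 0 \<le> V x' y' k" using V_nonneg by simp
    qed (use V_nonneg \<kappa>(1) in auto)
  qed
qed

subsection \<open>PAPC\<close>

lemma papc_bounded_gap_sums:
  assumes run: "papc \<tau> \<eta> df h A x s" and a1: "\<alpha> < 1" and b43: "\<beta> < 4 / 3" and g0: "g = (\<lambda>_. 0)"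
  shows "bounded_gap_sums (\<lambda>k. x (Suc k)) s"
proof -
  have x_Suc: "x (Suc k) = x k - \<tau> *\<^sub>R df (x k) - \<tau> *\<^sub>R At (s (Suc k))" for k
    using run by (simp add: papc_def)
  have subG: "0 \<in> subdifferential g x'" for x' by (simp add: subdifferential_def g0)
  have subH: "(1 / \<eta>) *\<^sub>R (s k - s (Suc k)) + A (x (Suc k) + \<tau> *\<^sub>R At (s (Suc k) - s k))
      \<in> subdifferential (conjugate h) (s (Suc k))" for k
  proof (rule prox_h)
    have arg: "s k - (\<tau> * \<eta>) *\<^sub>R A (At (s k)) + \<eta> *\<^sub>R A (x k - \<tau> *\<^sub>R df (x k)) =
      s (Suc k) + \<eta> *\<^sub>R ((1 / \<eta>) *\<^sub>R (s k - s (Suc k)) + A (x (Suc k) + \<tau> *\<^sub>R At (s (Suc k) - s k)))"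
      using eta by (simp add: x_Suc linear_add[OF A] linear_diff[OF A] linear_scale[OF A]
        linear_diff[OF At_linear] algebra_simps)
    have "s (Suc k) = prox \<eta> (conjugate h)
        (s k - (\<tau> * \<eta>) *\<^sub>R A (At (s k)) + \<eta> *\<^sub>R A (x k - \<tau> *\<^sub>R df (x k)))"
      using run unfolding papc_def by blast
    then show "s (Suc k) = prox \<eta> (conjugate h) (s (Suc k) + \<eta> *\<^sub>R ((1 / \<eta>) *\<^sub>R (s k - s (Suc k)) +
        A (x (Suc k) + \<tau> *\<^sub>R At (s (Suc k) - s k))))"
      by (simp only: arg)
  qed
  have fin: "g (x (Suc k)) \<noteq> \<infinity>" "conjugate h (s (Suc k)) \<noteq> \<infinity>" for k
    using subdifferential_real(1)[OF proper_hc subH] by (auto simp: g0)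
  \<comment> \<open>The zero function has only the zero subgradient: test the inequality in the
    direction of the subgradient itself.\<close>
  have At_ss: "At ss = - df xs"
  proof -
    have "ereal ((- df xs - At ss) \<bullet> (y - xs)) \<le> 0" for y
      using opt_x by (simp add: subdifferential_def g0)
    from this[of "xs + (- df xs - At ss)"] have "(- df xs - At ss) \<bullet> (- df xs - At ss) \<le> 0" by simp
    then have "- df xs - At ss = 0" by (metis inner_gt_zero_iff not_less)
    then show ?thesis by (simp add: algebra_simps eq_neg_iff_add_eq_0)
  qed
  \<comment> \<open>\<open>\<theta>\<close> is 1 or 1/\<beta>, and \<beta> < 4/3 places it above
    3/4. It measures how far \<open>Q\<close> can be negative: by at most the fraction 1 - \<theta>
    of \<tau> |At w|^2.\<close>
  obtain \<theta> where \<theta>: "3 / 4 < \<theta>" "\<theta> \<le> 1" "\<theta> * \<beta> \<le> 1"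
  proof (cases "\<beta> \<le> 1")
    case True
    then show ?thesis by (intro that[of 1]) auto
  next
    case False
    then show ?thesis using b43 by (intro that[of "1 / \<beta>"]) (auto simp: field_simps)
  qed
  define Q where "Q w = (norm w)\<^sup>2 / \<eta> - \<tau> * (norm (At w))\<^sup>2" for w
  define \<kappa> where "\<kappa> = (1 - \<theta>) / \<tau>"
  have \<kappa>: "0 \<le> \<kappa>" using \<theta> tau by (simp add: \<kappa>_def)
  have Q_ge: "- (\<kappa> * (norm (\<tau> *\<^sub>R At w))\<^sup>2) \<le> Q w" for w
  proof -
    have "\<theta> * (\<tau> * (norm (At w))\<^sup>2) \<le> \<theta> * (\<beta> / \<eta> * (norm w)\<^sup>2)"
      using \<theta>(1) by (intro mult_left_mono norm_At_sq) simp
    also have "\<dots> = (\<theta> * \<beta>) * ((norm w)\<^sup>2 / \<eta>)" by simp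
    also have "\<dots> \<le> 1 * ((norm w)\<^sup>2 / \<eta>)" using \<theta>(3) eta by (intro mult_right_mono) auto
    finally have 1: "\<theta> * (\<tau> * (norm (At w))\<^sup>2) \<le> (norm w)\<^sup>2 / \<eta>" by simp
    have "\<kappa> * (norm (\<tau> *\<^sub>R At w))\<^sup>2 = (1 - \<theta>) * (\<tau> * (norm (At w))\<^sup>2)"
      using tau by (simp add: \<kappa>_def power_mult_distrib power2_eq_square)
    then show ?thesis using 1 by (simp add: Q_def algebra_simps)
  qed
  define d where "d k = df (x k) - df xs" for k
  \<comment> \<open>The deviation of the adjoint dual variable from its saddle value. By
    \<open>q_Suc\<close>, which uses At ss = -df xs, it is a combination of the primal step and the
    gradient residual, and can therefore absorb the negative part of \<open>Q\<close>.\<close>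
  define q where "q k = - \<tau> *\<^sub>R At (s k - ss)" for k
  have q_Suc: "q (Suc k) = x (Suc k) - x k + \<tau> *\<^sub>R d k" for k
    by (simp add: q_def d_def x_Suc linear_diff[OF At_linear] At_ss algebra_simps)
  define V where "V x' y' k = (norm (x k - x'))\<^sup>2 / (2 * \<tau>) + Q (s k - y') / 2" for x' y' k
  have step: "nonsmooth_gap x' y' (x (Suc k)) (s (Suc k)) \<le> - (df (x k) \<bullet> (x (Suc k) - x')) + V x' y' k - V x' y' (Suc k)
      - (norm (x (Suc k) - x k))\<^sup>2 / (2 * \<tau>) - Q (s (Suc k) - s k) / 2"
    if dom: "g x' \<noteq> \<infinity>" "conjugate h y' \<noteq> \<infinity>" for x' y' k
  proof -
    let ?s = "s (Suc k)" and ?x = "x (Suc k)"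
    have 1: "V x' y' k - V x' y' (Suc k) - (norm (?x - x k))\<^sup>2 / (2 * \<tau>) - Q (?s - s k) / 2 =
        ((1 / \<tau>) *\<^sub>R (x k - ?x)) \<bullet> (?x - x') + (1 / \<eta>) * ((s k - ?s) \<bullet> (?s - y'))
          - \<tau> * (At (s k - ?s) \<bullet> At (?s - y'))"
      using tau eta unfolding V_def Q_def power2_norm_eq_inner
      by (simp add: A_simps inner_simps inner_commute diff_divide_distrib add_divide_distrib algebra_simps)
    have 2: "(1 / \<tau>) *\<^sub>R (x k - ?x) = df (x k) + At ?s"
      using tau by (simp add: x_Suc algebra_simps)
    show ?thesis
      using nonsmooth_gap_le[OF dom subG[of ?x] subH[of k]] 1 unfolding 2
      by (simp add: A_simps inner_simps inner_commute algebra_simps)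
  qed
  have Q_diff: "Q (s (Suc k) - s k) / 2 \<ge> - (\<kappa> * ((norm (q k))\<^sup>2 + (norm (q (Suc k)))\<^sup>2))" for k
  proof -
    have "\<tau> *\<^sub>R At (s (Suc k) - s k) = q k - q (Suc k)"
      by (simp add: q_def linear_diff[OF At_linear] algebra_simps)
    then have "(norm (\<tau> *\<^sub>R At (s (Suc k) - s k)))\<^sup>2 \<le> 2 * (norm (q k))\<^sup>2 + 2 * (norm (q (Suc k)))\<^sup>2"
      using norm_diff_sq_le[of "q k" "q (Suc k)"] by simp
    then have "\<kappa> * (norm (\<tau> *\<^sub>R At (s (Suc k) - s k)))\<^sup>2 \<le> \<kappa> * (2 * (norm (q k))\<^sup>2 + 2 * (norm (q (Suc k)))\<^sup>2)"
      using \<kappa> by (rule mult_left_mono)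
    then show ?thesis using Q_ge[of "s (Suc k) - s k"] by (simp add: algebra_simps)
  qed
  \<comment> \<open>The added term pays for the old \<open>q k\<close> in \<open>Q_diff\<close> and
    also compensates the possible negativity of \<open>Q\<close> inside \<open>V\<close>. At the
    saddle point \<open>V'\<close> is then nonnegative, elsewhere bounded below by a constant of the
    test pair.\<close>
  define V' where "V' x' y' k = V x' y' k + \<kappa> * (norm (q k))\<^sup>2" for x' y' k
  have V'_ge: "- (\<kappa> * (norm (\<tau> *\<^sub>R At (ss - y')))\<^sup>2) \<le> V' x' y' k" for x' y' k
  proof -
    have "\<tau> *\<^sub>R At (s k - y') = \<tau> *\<^sub>R At (ss - y') - q k"
      by (simp add: q_def linear_diff[OF At_linear] algebra_simps)
    then have "(norm (\<tau> *\<^sub>R At (s k - y')))\<^sup>2 \<le> 2 * (norm (\<tau> *\<^sub>R At (ss - y')))\<^sup>2 + 2 * (norm (q k))\<^sup>2"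
      using norm_diff_sq_le[of "\<tau> *\<^sub>R At (ss - y')" "q k"] by simp
    then have "\<kappa> * (norm (\<tau> *\<^sub>R At (s k - y')))\<^sup>2 \<le> \<kappa> * (2 * (norm (\<tau> *\<^sub>R At (ss - y')))\<^sup>2 + 2 * (norm (q k))\<^sup>2)"
      using \<kappa> by (rule mult_left_mono)
    moreover have "0 \<le> (norm (x k - x'))\<^sup>2 / (2 * \<tau>)" using tau by simp
    ultimately show ?thesis using Q_ge[of "s k - y'"] by (simp add: V'_def V_def algebra_simps)
  qed
  define e where "e k = (norm (q (Suc k)))\<^sup>2 + (norm (d k))\<^sup>2" for k
  \<comment> \<open>One \<kappa> comes from \<open>Q_diff\<close> and one from the new term of
    \<open>V'\<close>. Positivity of the two entries amounts to \<theta> > 3/4 and to \<alpha> <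
    1.\<close>
  define c where "c = min (1 / (2 * \<tau>) - 2 * \<kappa>) (1 / L - \<tau> / 2)"
  have c: "c > 0"
    using \<theta>(1) a1 tau L_pos by (auto simp: c_def \<kappa>_def alpha field_simps)
  show ?thesis unfolding bounded_gap_sums_def
  proof (intro conjI allI impI fin)
    fix x' y' assume dom: "g x' \<noteq> \<infinity>" "conjugate h y' \<noteq> \<infinity>"
    show "\<exists>C. \<forall>K. (\<Sum>k<K. f (x (Suc k)) - f x' + nonsmooth_gap x' y' (x (Suc k)) (s (Suc k))) \<le> C"
    proof (rule sum_bound_of_lyapunov)
      fix k
      let ?D = "x (Suc k) - x k"
      have "df xs \<bullet> (x (Suc k) - xs) - df (x k) \<bullet> (x (Suc k) - xs) = - (d k \<bullet> (x k - xs)) - d k \<bullet> ?D"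
        by (simp add: d_def inner_simps)
      also have "\<dots> \<le> - ((norm (d k))\<^sup>2 / L) - d k \<bullet> ?D" using cocoercive[of "x k"] by (simp add: d_def)
      finally have 1: "df xs \<bullet> (x (Suc k) - xs) - df (x k) \<bullet> (x (Suc k) - xs) \<le> - ((norm (d k))\<^sup>2 / L) - d k \<bullet> ?D" .
      \<comment> \<open>Completing the square in ?D + \<tau> d k, which is
        \<open>q (Suc k)\<close>.\<close>
      have 2: "(norm ?D)\<^sup>2 / (2 * \<tau>) + d k \<bullet> ?D = (norm (q (Suc k)))\<^sup>2 / (2 * \<tau>) - \<tau> / 2 * (norm (d k))\<^sup>2"
        using tau unfolding q_Suc power2_norm_eq_inner
        by (simp add: inner_simps inner_commute power2_eq_square field_simps)
      have 3: "c * e k \<le> (1 / (2 * \<tau>) - 2 * \<kappa>) * (norm (q (Suc k)))\<^sup>2 + (1 / L - \<tau> / 2) * (norm (d k))\<^sup>2"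
        unfolding e_def distrib_left by (intro add_mono mult_right_mono) (auto simp: c_def)
      show "V' xs ss (Suc k) \<le> V' xs ss k - c * e k"
        using step[OF saddle_finite, of k] nonsmooth_gap_saddle[OF fin, of k k] 1 2 3 Q_diff[of k]
        unfolding V'_def by (simp add: algebra_simps)
      show "0 \<le> V' xs ss k"
        using V'_ge[of ss xs k] by (simp add: linear_0[OF At_linear])
    next
      fix k
      let ?D = "x (Suc k) - x k"
      have D: "?D = q (Suc k) - \<tau> *\<^sub>R d k" by (simp add: q_Suc)
      have "(norm ?D)\<^sup>2 \<le> 2 * (norm (q (Suc k)))\<^sup>2 + 2 * \<tau>\<^sup>2 * (norm (d k))\<^sup>2"
        unfolding D using norm_diff_sq_le[of "q (Suc k)" "\<tau> *\<^sub>R d k"] by (simp add: power_mult_distrib)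
      also have "\<dots> \<le> 2 * (1 + \<tau>\<^sup>2) * e k" by (simp add: e_def algebra_simps)
      finally have "L / 2 * (norm ?D)\<^sup>2 \<le> L / 2 * (2 * (1 + \<tau>\<^sup>2) * e k)"
        using L_pos by (intro mult_left_mono) auto
      moreover have "2 * \<kappa> * (norm (q (Suc k)))\<^sup>2 \<le> 2 * \<kappa> * e k"
        using \<kappa> by (intro mult_left_mono) (auto simp: e_def)
      moreover have "0 \<le> (norm ?D)\<^sup>2 / (2 * \<tau>)" using tau by simp
      ultimately show "f (x (Suc k)) - f x' + nonsmooth_gap x' y' (x (Suc k)) (s (Suc k))
        \<le> V' x' y' k - V' x' y' (Suc k) + (L * (1 + \<tau>\<^sup>2) + 2 * \<kappa>) * e k"
        using step[OF dom, of k] smooth_gap_le[of "x (Suc k)" x' "x k"] Q_diff[of k]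
        unfolding V'_def by (simp add: algebra_simps)
      show "- (\<kappa> * (norm (\<tau> *\<^sub>R At (ss - y')))\<^sup>2) \<le> V' x' y' k" by (rule V'_ge)
    qed (use c \<kappa> L_pos in auto)
  qed
qed

subsection \<open>PDDY\<close>

lemma pddy_bounded_gap_sums:
  assumes run: "pddy \<tau> \<eta> df g h A x y s" and a1: "\<alpha> < 1"
    and b: "\<beta> < (4 * \<alpha> - 3 + sqrt (9 - 8 * \<alpha>)) / (2 * \<alpha>)"
    and y0: "g (y 0) \<noteq> \<infinity>"
  shows "bounded_gap_sums y s"
proof -
  have x_Suc: "x (Suc k) = y k - \<tau> *\<^sub>R At (s (Suc k) - s k)" for k
    using run by (simp add: pddy_def)
  have subG: "(1 / \<tau>) *\<^sub>R (x (Suc k) - y (Suc k)) - df (x (Suc k)) - At (s (Suc k)) \<in> subdifferential g (y (Suc k))" for k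
  proof (rule prox_g)
    have arg: "y (Suc k) + \<tau> *\<^sub>R ((1 / \<tau>) *\<^sub>R (x (Suc k) - y (Suc k)) - df (x (Suc k)) - At (s (Suc k))) =
        x (Suc k) - \<tau> *\<^sub>R At (s (Suc k)) - \<tau> *\<^sub>R df (x (Suc k))"
      using tau by (simp add: algebra_simps)
    have "y (Suc k) = prox \<tau> g (x (Suc k) - \<tau> *\<^sub>R At (s (Suc k)) - \<tau> *\<^sub>R df (x (Suc k)))"
      using run unfolding pddy_def by blast
    then show "y (Suc k) = prox \<tau> g (y (Suc k) + \<tau> *\<^sub>R
        ((1 / \<tau>) *\<^sub>R (x (Suc k) - y (Suc k)) - df (x (Suc k)) - At (s (Suc k))))"
      unfolding arg .
  qed
  have subH: "(1 / \<eta>) *\<^sub>R (s k - s (Suc k)) + A (y k) \<in> subdifferential (conjugate h) (s (Suc k))" for k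
  proof (rule prox_h)
    have arg: "s (Suc k) + \<eta> *\<^sub>R ((1 / \<eta>) *\<^sub>R (s k - s (Suc k)) + A (y k)) = s k + \<eta> *\<^sub>R A (y k)"
      using eta by (simp add: algebra_simps)
    have "s (Suc k) = prox \<eta> (conjugate h) (s k + \<eta> *\<^sub>R A (y k))"
      using run unfolding pddy_def by blast
    then show "s (Suc k) = prox \<eta> (conjugate h) (s (Suc k) + \<eta> *\<^sub>R ((1 / \<eta>) *\<^sub>R (s k - s (Suc k)) + A (y k)))"
      unfolding arg .
  qed
  \<comment> \<open>For positive \<open>k\<close> the output \<open>y k\<close> comes from the prox
    of step \<open>k - 1\<close>; index 0 rests on the assumption about the initial point.\<close>
  have fin: "g (y k) \<noteq> \<infinity>" "conjugate h (s (Suc k)) \<noteq> \<infinity>" for k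
    using subdifferential_real(1)[OF proper_g subG[of "k - 1"]] subdifferential_real(1)[OF proper_hc subH[of k]] y0
    by (cases k; auto)+
  obtain \<theta> where \<theta>: "1 / 2 < \<theta>" "\<theta> \<le> 1" "\<theta> * \<beta> \<le> 1" "1 - \<theta> < (2 * \<theta> - 1)\<^sup>2 * (1 - \<alpha>)"
    using pddy_stepsize[OF alpha_pos a1 b] by blast
  \<comment> \<open>Bilinear form of I/\<eta> - \<theta>\<tau> A At, positive semidefinite because
    \<theta>\<beta> is at most 1, even if \<beta> > 1. The omitted share 1 - \<theta> reappears as a
    multiple of |a k|^2 that must be paid for.\<close>
  define M where "M v w = (v \<bullet> w) / \<eta> - \<theta> * \<tau> * (At v \<bullet> At w)" for v w
  have M_nonneg: "0 \<le> M w w" for w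
  proof -
    have "\<theta> * (\<tau> * (norm (At w))\<^sup>2) \<le> \<theta> * (\<beta> / \<eta> * (norm w)\<^sup>2)"
      using \<theta>(1) by (intro mult_left_mono norm_At_sq) simp
    also have "\<dots> = (\<theta> * \<beta>) * ((norm w)\<^sup>2 / \<eta>)" by simp
    also have "\<dots> \<le> 1 * ((norm w)\<^sup>2 / \<eta>)" using \<theta>(3) eta by (intro mult_right_mono) auto
    finally show ?thesis by (simp add: M_def power2_norm_eq_inner)
  qed
  have M_young: "M v w \<le> M v v / 2 + M w w / 2" for v w
  proof -
    have "M (v - w) (v - w) = M v v + M w w - 2 * M v w"
      unfolding M_def
      by (simp add: A_simps inner_simps inner_commute diff_divide_distrib add_divide_distrib algebra_simps)
    then show ?thesis using M_nonneg[of "v - w"] by argo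
  qed
  define D where "D k = s (Suc k) - s k" for k
  define a where "a k = \<tau> *\<^sub>R At (D k)" for k
  define d where "d k = \<tau> *\<^sub>R (df (x k) - df xs)" for k
  have d_inner: "(1 / \<tau>) * (d k \<bullet> v) = (df (x k) - df xs) \<bullet> v" for k v
    using tau by (simp add: d_def)
  define r where "r k = y k - x k + d k" for k
  have y_eq: "y k = x (Suc k) + a k" for k by (simp add: x_Suc a_def D_def)
  define V where "V x' y' k = (norm (x k - x'))\<^sup>2 / (2 * \<tau>) + (norm (s k - y'))\<^sup>2 / (2 * \<eta>)" for x' y' k
  have V_nonneg: "0 \<le> V x' y' k" for x' y' k using tau eta by (simp add: V_def)
  define N where "N k = M (D k) (D k) + \<theta> / \<tau> * (norm (a k))\<^sup>2" for k
  have N_eq: "N k = (norm (D k))\<^sup>2 / \<eta>" for k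
  proof -
    have "(norm (a k))\<^sup>2 = \<tau> * (\<tau> * (At (D k) \<bullet> At (D k)))"
      unfolding a_def power2_norm_eq_inner by simp
    then show ?thesis using tau by (simp add: N_def M_def power2_norm_eq_inner[of "D k"])
  qed
  \<comment> \<open>The subgradient of \<open>g\<close> at \<open>y k\<close> was produced in the
    preceding iteration, so the bound starts at index 1.\<close>
  have step: "nonsmooth_gap x' y' (y k) (s (Suc k)) \<le> - (df (x k) \<bullet> (y k - x')) + V x' y' k - V x' y' (Suc k)
      - (norm (y k - x k))\<^sup>2 / (2 * \<tau>) + (norm (a k))\<^sup>2 / (2 * \<tau>) - N k / 2"
    if dom: "g x' \<noteq> \<infinity>" "conjugate h y' \<noteq> \<infinity>" and k: "k \<noteq> 0" for x' y' k
  proof -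
    obtain j where j: "k = Suc j" using k by (cases k) auto
    have 1: "V x' y' k - V x' y' (Suc k) - (norm (x (Suc k) - x k))\<^sup>2 / (2 * \<tau>) - (norm (D k))\<^sup>2 / (2 * \<eta>) =
        (1 / \<tau>) * ((x k - x (Suc k)) \<bullet> (x (Suc k) - x')) + (1 / \<eta>) * ((s k - s (Suc k)) \<bullet> (s (Suc k) - y'))"
      using tau eta unfolding V_def D_def power2_norm_eq_inner
      by (simp add: inner_simps inner_commute diff_divide_distrib add_divide_distrib algebra_simps)
    have 2: "(norm (y k - x k))\<^sup>2 / (2 * \<tau>) - (norm (a k))\<^sup>2 / (2 * \<tau>) =
        (norm (x (Suc k) - x k))\<^sup>2 / (2 * \<tau>) + (1 / \<tau>) * ((x (Suc k) - x k) \<bullet> a k)"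
      using tau unfolding y_eq power2_norm_eq_inner
      by (simp add: inner_simps inner_commute diff_divide_distrib add_divide_distrib algebra_simps)
    have 3: "(1 / \<tau>) * (a k \<bullet> v) = At (D k) \<bullet> v" for v using tau by (simp add: a_def)
    have 4: "(1 / \<tau>) * ((x k - x (Suc k)) \<bullet> (x (Suc k) - x')) - (1 / \<tau>) * ((x (Suc k) - x k) \<bullet> a k)
       = (1 / \<tau>) * ((x k - y k) \<bullet> (y k - x')) + At (D k) \<bullet> (y k - x')"
      unfolding 3[symmetric] unfolding y_eq
      using tau by (simp add: inner_simps inner_commute diff_divide_distrib add_divide_distrib algebra_simps)
    show ?thesis
      using nonsmooth_gap_le[OF dom subG[of j] subH[of k]] 1 2 4
      unfolding N_eq j[symmetric] by (simp add: D_def A_simps inner_simps inner_commute algebra_simps)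
  qed
  \<comment> \<open>Monotonicity of the subdifferential of the conjugate between two consecutive
    dual outputs, tested with their difference \<open>D (Suc k)\<close>.\<close>
  have mono: "N (Suc k) \<le> D k \<bullet> D (Suc k) / \<eta> + (1 / \<tau>) * ((r (Suc k) - d (Suc k) - a k) \<bullet> a (Suc k))" for k
  proof -
    have "(((1 / \<eta>) *\<^sub>R (s k - s (Suc k)) + A (y k)) - ((1 / \<eta>) *\<^sub>R (s (Suc k) - s (Suc (Suc k))) + A (y (Suc k))))
        \<bullet> (s (Suc (Suc k)) - s (Suc k)) \<le> 0"
      using subdifferential_real(2)[OF proper_hc subH[of k] fin(2)[of "Suc k"]]
        subdifferential_real(2)[OF proper_hc subH[of "Suc k"] fin(2)[of k]]
      by (simp add: inner_diff_left inner_diff_right)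
    then have "(norm (D (Suc k)))\<^sup>2 / \<eta> \<le> D k \<bullet> D (Suc k) / \<eta> + (y (Suc k) - y k) \<bullet> At (D (Suc k))"
      unfolding D_def power2_norm_eq_inner
      by (simp add: A_simps inner_simps inner_commute diff_divide_distrib add_divide_distrib algebra_simps)
    moreover have "y (Suc k) - y k = r (Suc k) - d (Suc k) - a k"
      by (simp add: r_def y_eq[of k])
    moreover have "v \<bullet> At (D (Suc k)) = (1 / \<tau>) * (v \<bullet> a (Suc k))" for v using tau by (simp add: a_def)
    ultimately show ?thesis unfolding N_eq by simp
  qed
  \<comment> \<open>Chosen so that \<open>mono\<close>, after Young estimates of its two cross terms
    between \<open>D k\<close> and \<open>D (Suc k)\<close>, telescopes and releases (2\<theta> -
    1)/\<tau> times |a (Suc k)|^2.\<close>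
  define T where "T k = M (D k) (D k) / 2 + (1 - \<theta>) / (2 * \<tau>) * (norm (a k))\<^sup>2" for k
  have T_nonneg: "0 \<le> T k" for k using M_nonneg \<theta> tau by (simp add: T_def)
  have T_step: "T (Suc k) \<le> T k + (1 / \<tau>) * ((r (Suc k) - d (Suc k)) \<bullet> a (Suc k))
      - (2 * \<theta> - 1) / \<tau> * (norm (a (Suc k)))\<^sup>2" for k
  proof -
    let ?ba = "a k \<bullet> a (Suc k)"
    have 1: "D k \<bullet> D (Suc k) / \<eta> = M (D k) (D (Suc k)) + \<theta> / \<tau> * ?ba"
      using tau by (simp add: M_def a_def)
    have 2: "M (D (Suc k)) (D (Suc k)) + \<theta> / \<tau> * (norm (a (Suc k)))\<^sup>2 \<le> M (D k) (D k) / 2 + M (D (Suc k)) (D (Suc k)) / 2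
        + (1 / \<tau>) * ((r (Suc k) - d (Suc k)) \<bullet> a (Suc k)) - (1 - \<theta>) / \<tau> * ?ba"
      using mono[of k] M_young[of "D k" "D (Suc k)"] unfolding 1 N_def
      by (simp add: inner_simps diff_divide_distrib algebra_simps)
    have "- ?ba \<le> (norm (a k))\<^sup>2 / 2 + (norm (a (Suc k)))\<^sup>2 / 2"
      using young_inner[of 1 "- a k" "a (Suc k)"] by (simp add: add_divide_distrib)
    then have "(1 - \<theta>) / \<tau> * (- ?ba) \<le> (1 - \<theta>) / \<tau> * ((norm (a k))\<^sup>2 / 2 + (norm (a (Suc k)))\<^sup>2 / 2)"
      using \<theta> tau by (intro mult_left_mono) auto
    then show ?thesis using 2 unfolding T_def
      by (simp add: diff_divide_distrib add_divide_distrib algebra_simps)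
  qed
  \<comment> \<open>The multiple of the monotonicity estimate that is added. Completing squares in
    \<open>r\<close> and \<open>d\<close> leaves 2\<mu>(2\<theta> - 1) - \<mu>^2/(1 - \<alpha>) - (1
    - \<theta>) as coefficient of |a|^2; this \<mu> maximises it, and the maximum is
    \<open>\<delta>\<close>.\<close>
  define \<mu> where "\<mu> = (2 * \<theta> - 1) * (1 - \<alpha>)"
  have \<mu>: "0 \<le> \<mu>" using \<theta> a1 by (simp add: \<mu>_def)
  define \<delta> where "\<delta> = (2 * \<theta> - 1)\<^sup>2 * (1 - \<alpha>) - (1 - \<theta>)"
  have \<delta>: "0 < \<delta>" using \<theta>(4) by (simp add: \<delta>_def)
  \<comment> \<open>Coefficient of |d|^2: cocoercivity gives 1/\<alpha>, and 1 is spent on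
    completing the square that defines \<open>r\<close>.\<close>
  define \<rho> where "\<rho> = 1 / \<alpha> - 1"
  have \<rho>: "0 < \<rho>" using alpha_pos a1 by (simp add: \<rho>_def)
  have "(2 * \<mu>)\<^sup>2 < 4 * 1 * (\<mu>\<^sup>2 + \<delta> / 2)" using \<delta> by (simp add: power_mult_distrib)
  moreover have "0 < \<mu>\<^sup>2 + \<delta> / 2" using \<delta> by (simp add: add_nonneg_pos)
  ultimately obtain c1 where c1: "c1 > 0" "\<And>v w :: 'a. c1 * ((norm v)\<^sup>2 + (norm w)\<^sup>2) \<le>
      1 * (norm v)\<^sup>2 + (\<mu>\<^sup>2 + \<delta> / 2) * (norm w)\<^sup>2 + (- (2 * \<mu>)) * (v \<bullet> w)"
    using quadratic_form_coercive[where ?'a = 'a, of 1 "\<mu>\<^sup>2 + \<delta> / 2" "- (2 * \<mu>)"] by auto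
  have \<mu>\<rho>: "\<rho> * (\<mu>\<^sup>2 / \<rho>) = \<mu>\<^sup>2" using \<rho> by simp
  have "(2 * \<mu>)\<^sup>2 < 4 * \<rho> * (\<mu>\<^sup>2 / \<rho> + \<delta> / 2)"
    using \<delta> \<rho> \<mu>\<rho> by (simp add: power_mult_distrib distrib_left)
  moreover have "0 < \<mu>\<^sup>2 / \<rho> + \<delta> / 2" using \<delta> \<rho> by (simp add: add_nonneg_pos)
  ultimately obtain c2 where c2: "c2 > 0" "\<And>v w :: 'a. c2 * ((norm v)\<^sup>2 + (norm w)\<^sup>2) \<le>
      \<rho> * (norm v)\<^sup>2 + (\<mu>\<^sup>2 / \<rho> + \<delta> / 2) * (norm w)\<^sup>2 + (2 * \<mu>) * (v \<bullet> w)"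
    using quadratic_form_coercive[where ?'a = 'a, of \<rho> "\<mu>\<^sup>2 / \<rho> + \<delta> / 2" "2 * \<mu>"] \<rho> by auto
  \<comment> \<open>As 1 + 1/\<rho> = 1/(1 - \<alpha>), the coefficient of |a|^2 splits into the
    amounts needed for the cross terms with \<open>r\<close> and with \<open>d\<close>, each with a
    surplus \<delta>/2.\<close>
  have coeff: "(\<mu>\<^sup>2 + \<delta> / 2) + (\<mu>\<^sup>2 / \<rho> + \<delta> / 2) = 2 * \<mu> * (2 * \<theta> - 1) - (1 - \<theta>)"
  proof -
    have "\<mu>\<^sup>2 + \<mu>\<^sup>2 / \<rho> = \<mu>\<^sup>2 / (1 - \<alpha>)"
      unfolding \<rho>_def using alpha_pos a1 by (simp add: field_simps)
    also have "\<dots> = (2 * \<theta> - 1)\<^sup>2 * (1 - \<alpha>)"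
      using a1 by (simp add: \<mu>_def power_mult_distrib power2_eq_square)
    finally show ?thesis by (simp add: \<delta>_def \<mu>_def power2_eq_square algebra_simps)
  qed
  define c where "c = min c1 c2 / (2 * \<tau>)"
  have c: "0 < c" using c1(1) c2(1) tau by (simp add: c_def)
  define e where "e k = (norm (r k))\<^sup>2 + (norm (d k))\<^sup>2 + (norm (a k))\<^sup>2" for k
  have form: "2 * \<tau> * (c * e k) \<le> (norm (r k))\<^sup>2 + \<rho> * (norm (d k))\<^sup>2
      + (2 * \<mu> * (2 * \<theta> - 1) - (1 - \<theta>)) * (norm (a k))\<^sup>2 - 2 * \<mu> * ((r k - d k) \<bullet> a k)" for k
  proof -
    have "2 * \<tau> * (c * e k) = min c1 c2 * e k" using tau by (simp add: c_def)
    also have "\<dots> \<le> min c1 c2 * ((norm (r k))\<^sup>2 + (norm (a k))\<^sup>2) + min c1 c2 * ((norm (d k))\<^sup>2 + (norm (a k))\<^sup>2)"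
      using c1(1) c2(1) by (simp add: e_def distrib_left)
    also have "\<dots> \<le> c1 * ((norm (r k))\<^sup>2 + (norm (a k))\<^sup>2) + c2 * ((norm (d k))\<^sup>2 + (norm (a k))\<^sup>2)"
      by (intro add_mono mult_right_mono) auto
    finally show ?thesis using c1(2)[of "r k" "a k"] c2(2)[of "d k" "a k"]
      unfolding coeff[symmetric] by (simp add: inner_diff_left algebra_simps)
  qed
  \<comment> \<open>\<open>T k\<close> already involves the dual step of iteration \<open>k\<close>,
    hence it is paired with \<open>V\<close> after that iteration.\<close>
  define W where "W k = V xs ss (Suc k) + \<mu> * T k" for k
  show ?thesis unfolding bounded_gap_sums_def
  proof (intro conjI allI impI fin)
    fix x' y' assume dom: "g x' \<noteq> \<infinity>" "conjugate h y' \<noteq> \<infinity>"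
    define t where "t k = f (y k) - f x' + nonsmooth_gap x' y' (y k) (s (Suc k))" for k
    have "\<exists>C. \<forall>K. (\<Sum>k<K. t (Suc k)) \<le> C"
    proof (rule sum_bound_of_lyapunov)
      fix j
      define k where "k = Suc j"
      have k: "k \<noteq> 0" by (simp add: k_def)
      have "df xs \<bullet> (y k - xs) - df (x k) \<bullet> (y k - xs) = - ((df (x k) - df xs) \<bullet> (x k - xs)) - (1 / \<tau>) * (d k \<bullet> (y k - x k))"
        unfolding d_inner by (simp add: inner_simps)
      also have "\<dots> \<le> - ((norm (df (x k) - df xs))\<^sup>2 / L) - (1 / \<tau>) * (d k \<bullet> (y k - x k))"
        using cocoercive[of "x k"] by simp
      also have "(norm (df (x k) - df xs))\<^sup>2 / L = (norm (d k))\<^sup>2 / (2 * \<tau> * \<alpha>)"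
      proof -
        have "(norm (d k))\<^sup>2 = \<tau>\<^sup>2 * (norm (df (x k) - df xs))\<^sup>2"
          unfolding d_def norm_scaleR power_mult_distrib by simp
        then show ?thesis using tau L_pos by (simp add: alpha power2_eq_square)
      qed
      finally have 1: "df xs \<bullet> (y k - xs) - df (x k) \<bullet> (y k - xs) \<le> - ((norm (d k))\<^sup>2 / (2 * \<tau> * \<alpha>)) - (1 / \<tau>) * (d k \<bullet> (y k - x k))" .
      have 2: "2 * \<tau> * (V xs ss (Suc k)) \<le> 2 * \<tau> * V xs ss k - (norm (r k))\<^sup>2 - \<rho> * (norm (d k))\<^sup>2
         + (norm (a k))\<^sup>2 - \<tau> * N k"
      proof -
        have "(norm (r k))\<^sup>2 = (norm (y k - x k))\<^sup>2 + 2 * (d k \<bullet> (y k - x k)) + (norm (d k))\<^sup>2"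
          unfolding r_def power2_norm_eq_inner by (simp add: inner_simps inner_commute)
        moreover have "0 \<le> 2 * \<tau> * (- ((norm (d k))\<^sup>2 / (2 * \<tau> * \<alpha>)) - (1 / \<tau>) * (d k \<bullet> (y k - x k)) + V xs ss k - V xs ss (Suc k)
          - (norm (y k - x k))\<^sup>2 / (2 * \<tau>) + (norm (a k))\<^sup>2 / (2 * \<tau>) - N k / 2)"
          using step[OF saddle_finite k] nonsmooth_gap_saddle[OF fin, of k k] 1 tau
          by (intro mult_nonneg_nonneg) linarith+
        moreover have "2 * \<tau> * (- ((norm (d k))\<^sup>2 / (2 * \<tau> * \<alpha>)) - (1 / \<tau>) * (d k \<bullet> (y k - x k)) + V xs ss k - V xs ss (Suc k)
          - (norm (y k - x k))\<^sup>2 / (2 * \<tau>) + (norm (a k))\<^sup>2 / (2 * \<tau>) - N k / 2) =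
          - (1 / \<alpha>) * (norm (d k))\<^sup>2 - 2 * (d k \<bullet> (y k - x k)) + 2 * \<tau> * V xs ss k - 2 * \<tau> * V xs ss (Suc k)
          - (norm (y k - x k))\<^sup>2 + (norm (a k))\<^sup>2 - \<tau> * N k"
          using tau alpha_pos by (simp add: field_simps)
        ultimately show ?thesis by (simp add: \<rho>_def algebra_simps)
      qed
      have N: "\<theta> * (norm (a k))\<^sup>2 \<le> \<tau> * N k"
        using M_nonneg[of "D k"] tau by (simp add: N_def distrib_left)
      have T: "2 * \<tau> * (\<mu> * T k) \<le> 2 * \<tau> * (\<mu> * T j) + 2 * \<mu> * ((r k - d k) \<bullet> a k) - 2 * \<mu> * (2 * \<theta> - 1) * (norm (a k))\<^sup>2"
      proof -
        have "2 * \<tau> * (\<mu> * T k) \<le> 2 * \<tau> * (\<mu> * (T j + (1 / \<tau>) * ((r k - d k) \<bullet> a k) - (2 * \<theta> - 1) / \<tau> * (norm (a k))\<^sup>2))"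
          using T_step[of j] \<mu> tau unfolding k_def by (intro mult_left_mono) auto
        also have "\<dots> = 2 * \<tau> * (\<mu> * T j) + 2 * \<mu> * ((r k - d k) \<bullet> a k) - 2 * \<mu> * (2 * \<theta> - 1) * (norm (a k))\<^sup>2"
          using tau by (simp add: field_simps)
        finally show ?thesis .
      qed
      have "2 * \<tau> * W k \<le> 2 * \<tau> * (W j - c * e k)"
        using 2 N T form[of k] unfolding W_def k_def by (simp add: algebra_simps)
      then show "W (Suc j) \<le> W j - c * e (Suc j)"
        using tau unfolding k_def by simp
      have yx: "y k - x k = r k - d k" by (simp add: r_def)
      have "(norm (y k - x k))\<^sup>2 \<le> 2 * e k"
        using norm_diff_sq_le[of "r k" "d k"] zero_le_power2[of "norm (a k)"]
        unfolding yx e_def by argo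
      then have "L / 2 * (norm (y k - x k))\<^sup>2 \<le> L * e k"
        using L_pos mult_left_mono[of "(norm (y k - x k))\<^sup>2" "2 * e k" "L / 2"] by simp
      moreover have "(norm (a k))\<^sup>2 / (2 * \<tau>) \<le> e k / (2 * \<tau>)"
        using tau by (intro divide_right_mono) (auto simp: e_def)
      moreover have "0 \<le> (norm (y k - x k))\<^sup>2 / (2 * \<tau>)" "0 \<le> N k" using tau eta by (auto simp: N_eq)
      ultimately have "t k \<le> V x' y' k - V x' y' (Suc k) + (L * e k + e k / (2 * \<tau>))"
        using step[OF dom k] smooth_gap_le[of "y k" x' "x k"] unfolding t_def by linarith
      then show "t (Suc j) \<le> V x' y' (Suc j) - V x' y' (Suc (Suc j)) + (L + 1 / (2 * \<tau>)) * e (Suc j)"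
        by (simp add: k_def algebra_simps)
      show "0 \<le> W j" using V_nonneg T_nonneg \<mu> by (simp add: W_def)
      show "- 0 \<le> V x' y' (Suc j)" using V_nonneg by simp
    qed (use c tau L_pos in auto)
    then obtain C where C: "\<And>K. (\<Sum>k<K. t (Suc k)) \<le> C" by blast
    \<comment> \<open>The initial output, not covered by \<open>step\<close>, contributes the single
      finite term \<open>t 0\<close>.\<close>
    have "(\<Sum>k<K. t k) \<le> \<bar>C\<bar> + \<bar>t 0\<bar>" for K
    proof (cases K)
      case (Suc n)
      then show ?thesis using C[of n] by (simp add: sum.lessThan_Suc_shift del: sum.lessThan_Suc)
    qed simp
    then show "\<exists>C. \<forall>K. (\<Sum>k<K. f (y k) - f x' + nonsmooth_gap x' y' (y k) (s (Suc k))) \<le> C"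
      unfolding t_def by blast
  qed
qed

subsection \<open>Ergodic gap\<close>

lemma generates_bounded_gap_sums:
  assumes run: "generates alg \<tau> \<eta> df g h A u s" and cond: "stepsize_condition alg \<alpha> \<beta>"
    and PAPC_g: "alg = PAPC \<Longrightarrow> g = (\<lambda>_. 0)" and PDDY_init: "alg = PDDY \<Longrightarrow> g (u 0) \<noteq> \<infinity>"
  shows "bounded_gap_sums u s"
proof (cases alg)
  case CondatVu
  then obtain x where "condat_vu \<tau> \<eta> df g h A x s" "u = (\<lambda>k. x (Suc k))" using run by auto
  then show ?thesis using condat_vu_bounded_gap_sums cond CondatVu by simp
next
  case PD3O
  then obtain z where "pd3o \<tau> \<eta> df g h A u z s" using run by (auto simp flip: fun_eq_iff)
  then show ?thesis using pd3o_bounded_gap_sums cond PD3O by simp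
next
  case PDDY
  then obtain x where "pddy \<tau> \<eta> df g h A x u s" using run by (auto simp flip: fun_eq_iff)
  then show ?thesis using pddy_bounded_gap_sums cond PDDY PDDY_init by simp
next
  case PAPC
  then obtain x where "papc \<tau> \<eta> df h A x s" "u = (\<lambda>k. x (Suc k))" using run by auto
  then show ?thesis using papc_bounded_gap_sums cond PAPC PAPC_g by simp
qed

lemma lagrangian_real:
  assumes "g x \<noteq> \<infinity>" "conjugate h y \<noteq> \<infinity>"
  shows "lagrangian f g h A x y = ereal (f x + G x + A x \<bullet> y - H y)"
  using assms proper_g proper_hc unfolding lagrangian_def proper_fun_def
  by (cases "g x"; cases "conjugate h y") auto

lemma ergodic_gap_bound:
  assumes bg: "bounded_gap_sums u s"
  shows "\<exists>C. \<forall>K\<ge>1. lagrangian f g h A (ergodic_average u K) y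
      - lagrangian f g h A x (ergodic_average (\<lambda>k. s (Suc k)) K) \<le> ereal (C / real K)"
proof -
  let ?u = "ergodic_average u" and ?s = "ergodic_average (\<lambda>k. s (Suc k))"
  have fin: "\<And>k. u k \<in> {x. g x \<noteq> \<infinity>}" "\<And>k. s (Suc k) \<in> {y. conjugate h y \<noteq> \<infinity>}"
    using bg by (auto simp: bounded_gap_sums_def)
  note cG = convex_on_real_of_ereal[OF g] and cH = convex_on_real_of_ereal[OF hc]
  have n: "g z \<noteq> - \<infinity>" "conjugate h w \<noteq> - \<infinity>" for z w
    using proper_g proper_hc by (auto simp: proper_fun_def)
  have fin_av: "g (?u K) \<noteq> \<infinity>" "conjugate h (?s K) \<noteq> \<infinity>" if "K \<ge> 1" for K
    using convex_on_ergodic_average(1)[where v = u, OF cG fin(1) that]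
      convex_on_ergodic_average(1)[where v = "\<lambda>k. s (Suc k)", OF cH fin(2) that] by auto
  show ?thesis
  proof (cases "g x = \<infinity> \<or> conjugate h y = \<infinity>")
    case True
    \<comment> \<open>The averages stay in the domains, so a test point outside its domain makes the
      gap minus infinity and the constant 0 suffices.\<close>
    have "lagrangian f g h A (?u K) y - lagrangian f g h A x (?s K) = - \<infinity>" if "K \<ge> 1" for K
      using True n(1)[of x] n(2)[of y] n(1)[of "?u K"] n(2)[of "?s K"] fin_av[OF that] unfolding lagrangian_def
      by (cases "g x"; cases "conjugate h y"; cases "g (?u K)"; cases "conjugate h (?s K)") auto
    then show ?thesis by (intro exI[of _ 0]) auto
  next
    case False
    then have dom: "g x \<noteq> \<infinity>" "conjugate h y \<noteq> \<infinity>" by auto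
    obtain C where C: "\<And>K. (\<Sum>k<K. f (u k) - f x + nonsmooth_gap x y (u k) (s (Suc k))) \<le> C"
      using bg False unfolding bounded_gap_sums_def by blast
    have "f (?u K) + G (?u K) + A (?u K) \<bullet> y - H y - (f x + G x + A x \<bullet> ?s K - H (?s K)) \<le> C / real K"
      if K: "K \<ge> 1" for K
    proof -
      have "f (?u K) \<le> (\<Sum>k<K. f (u k)) / real K"
        by (rule convex_on_ergodic_average(2)[OF f_convex _ K]) simp
      moreover have "G (?u K) \<le> (\<Sum>k<K. G (u k)) / real K"
        by (rule convex_on_ergodic_average(2)[OF cG fin(1) K])
      moreover have "H (?s K) \<le> (\<Sum>k<K. H (s (Suc k))) / real K"
        by (rule convex_on_ergodic_average(2)[OF cH fin(2) K])
      moreover have "A (?u K) \<bullet> y = (\<Sum>k<K. A (u k) \<bullet> y) / real K"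
        by (simp add: ergodic_average_def linear_scale[OF A] linear_sum[OF A] inner_sum_left)
      moreover have "A x \<bullet> ?s K = (\<Sum>k<K. A x \<bullet> s (Suc k)) / real K"
        by (simp add: ergodic_average_def inner_sum_right)
      moreover have "(\<Sum>k<K. f (u k) - f x + nonsmooth_gap x y (u k) (s (Suc k))) / real K =
        (\<Sum>k<K. f (u k)) / real K + (\<Sum>k<K. G (u k)) / real K + (\<Sum>k<K. H (s (Suc k))) / real K
        + (\<Sum>k<K. A (u k) \<bullet> y) / real K - (\<Sum>k<K. A x \<bullet> s (Suc k)) / real K - f x - G x - H y"
        using K by (simp add: nonsmooth_gap_def sum.distrib sum_subtractf field_simps)
      moreover have "(\<Sum>k<K. f (u k) - f x + nonsmooth_gap x y (u k) (s (Suc k))) / real K \<le> C / real K"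
        using C by (intro divide_right_mono) auto
      ultimately show ?thesis by linarith
    qed
    then show ?thesis
      by (intro exI[of _ C]) (simp add: lagrangian_real fin_av dom)
  qed
qed

end

theorem theorem4p1:
  fixes f :: "real ^ 'n \<Rightarrow> real" and df :: "real ^ 'n \<Rightarrow> real ^ 'n"
    and g :: "real ^ 'n \<Rightarrow> ereal" and h :: "real ^ 'm \<Rightarrow> ereal"
    and A :: "real ^ 'n \<Rightarrow> real ^ 'm"
    and L \<tau> \<eta> \<alpha> \<beta> :: real and alg :: algorithm
    and u :: "nat \<Rightarrow> real ^ 'n" and s :: "nat \<Rightarrow> real ^ 'm"
    and ubar :: "nat \<Rightarrow> real ^ 'n" and sbar :: "nat \<Rightarrow> real ^ 'm"
    and \<L> :: "real ^ 'n \<Rightarrow> real ^ 'm \<Rightarrow> ereal"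
  assumes f_convex: "convex_on UNIV f"
    and f_gradient: "\<And>x. GDERIV f x :> df x"
    and L_pos: "L > 0"
    and df_lipschitz: "L-lipschitz_on UNIV df"
    and g: "proper_closed_convex g"
    and h: "proper_closed_convex h"
    and A: "linear A"
    and Lagr: "\<L> = lagrangian f g h A"
    and saddle: "\<exists>xs ss. saddle_point \<L> xs ss"
    and steps: "\<tau> > 0" "\<eta> > 0"
    and alpha: "\<alpha> = \<tau> * L / 2"
    and beta: "\<beta> = \<tau> * \<eta> * (onorm A)\<^sup>2"
    and PAPC_g: "alg = PAPC \<Longrightarrow> g = (\<lambda>_. 0)"
    and PDDY_init: "alg = PDDY \<Longrightarrow> g (u 0) \<noteq> \<infinity>"
    and run: "generates alg \<tau> \<eta> df g h A u s"
    and cond: "stepsize_condition alg \<alpha> \<beta>"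
    and ubar: "ubar = ergodic_average u"
    and sbar: "sbar = ergodic_average (\<lambda>k. s (Suc k))"
  shows "(\<exists>C :: real ^ 'n \<Rightarrow> real ^ 'm \<Rightarrow> real.
            \<forall>x y. \<forall>K\<ge>1. \<L> (ubar K) y - \<L> x (sbar K) \<le> ereal (C x y / real K)) \<and>
         (\<forall>C :: real ^ 'n \<Rightarrow> real ^ 'm \<Rightarrow> real.
            (\<forall>x y. \<forall>K\<ge>1. \<L> (ubar K) y - \<L> x (sbar K) \<le> ereal (C x y / real K)) \<longrightarrow>
            (\<forall>X S. bdd_above ((\<lambda>(x, y). C x y) ` (X \<times> S)) \<longrightarrow>
               (\<exists>M. \<forall>K\<ge>1. (SUP (x, y) \<in> X \<times> S. \<L> (ubar K) y - \<L> x (sbar K)) \<le> ereal (M / real K))) \<and>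
            (\<forall>xs ss. saddle_point \<L> xs ss \<longrightarrow>
               (\<forall>K\<ge>1. 0 \<le> \<L> (ubar K) ss - \<L> xs (sbar K) \<and>
                  \<L> (ubar K) ss - \<L> xs (sbar K) \<le> ereal (C xs ss / real K))))"
proof (intro conjI allI impI)
  note hc = proper_closed_convex_conjugate[OF h]
  have ph: "proper_fun (conjugate h)" and pg: "proper_fun g"
    using hc g by (auto simp: proper_closed_convex_def)
  \<comment> \<open>Some saddle point is fixed as reference for the residuals; the last claim below
    concerns every saddle point.\<close>
  obtain xs ss where "saddle_point (lagrangian f g h A) xs ss" using saddle Lagr by blast
  then obtain v w where v: "0 = df xs + v + adjoint A ss" "v \<in> subdifferential g xs"
    and w: "0 = w - A xs" "w \<in> subdifferential (conjugate h) ss"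
    using saddle_point_lagrangian_iff[OF f_convex f_gradient g ph A] by blast
  have "v = (df xs + v + adjoint A ss) - df xs - adjoint A ss" by simp
  then have opt_x: "- df xs - adjoint A ss \<in> subdifferential g xs" using v by simp
  have opt_s: "A xs \<in> subdifferential (conjugate h) ss" using w by simp
  interpret saddle_problem f df g h A L \<tau> \<eta> \<alpha> \<beta> xs ss
    by (rule saddle_problem.intro[OF f_convex f_gradient L_pos df_lipschitz g h A steps alpha beta opt_x opt_s])
  have "bounded_gap_sums u s"
    by (rule generates_bounded_gap_sums[OF run cond PAPC_g PDDY_init])
  from ergodic_gap_bound[OF this]
  have "\<forall>x y. \<exists>C. \<forall>K\<ge>1. \<L> (ubar K) y - \<L> x (sbar K) \<le> ereal (C / real K)"
    unfolding Lagr ubar sbar by blast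
  \<comment> \<open>The constants obtained for each test pair are collected into a function by
    choice.\<close>
  then show "\<exists>C :: real ^ 'n \<Rightarrow> real ^ 'm \<Rightarrow> real.
      \<forall>x y. \<forall>K\<ge>1. \<L> (ubar K) y - \<L> x (sbar K) \<le> ereal (C x y / real K)"
    unfolding choice_iff .
  fix C :: "real ^ 'n \<Rightarrow> real ^ 'm \<Rightarrow> real"
  assume C: "\<forall>x y. \<forall>K\<ge>1. \<L> (ubar K) y - \<L> x (sbar K) \<le> ereal (C x y / real K)"
  show "\<exists>M. \<forall>K\<ge>1. (SUP (x, y) \<in> X \<times> S. \<L> (ubar K) y - \<L> x (sbar K)) \<le> ereal (M / real K)"
    if bdd: "bdd_above ((\<lambda>(x, y). C x y) ` (X \<times> S))" for X S
  proof -
    obtain M where "\<forall>z \<in> (\<lambda>(x, y). C x y) ` (X \<times> S). z \<le> M"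
      using bdd unfolding bdd_above_def by blast
    then have M: "C x y \<le> M" if "x \<in> X" "y \<in> S" for x y using that by force
    have "\<L> (ubar K) y - \<L> x (sbar K) \<le> ereal (M / real K)" if "K \<ge> 1" "x \<in> X" "y \<in> S" for K x y
    proof -
      have "ereal (C x y / real K) \<le> ereal (M / real K)"
        using M[OF that(2,3)] by (simp add: divide_right_mono)
      then show ?thesis using C that(1) order_trans by blast
    qed
    then show ?thesis by (intro exI[of _ M]) (auto intro!: SUP_least)
  qed
  fix xs' ss' K assume sp: "saddle_point \<L> xs' ss'" and K: "(1::nat) \<le> K"
  \<comment> \<open>A finite saddle value rules out differences of equal infinities when the two
    saddle inequalities are combined.\<close>
  have "\<bar>\<L> xs' ss'\<bar> \<noteq> \<infinity>"
    using saddle_point_lagrangian_finite[OF pg ph sp[unfolded Lagr]] unfolding Lagr lagrangian_def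
    by (cases "g xs'"; cases "conjugate h ss'") auto
  then show "0 \<le> \<L> (ubar K) ss' - \<L> xs' (sbar K)" by (rule saddle_point_gap_nonneg[OF sp])
  show "\<L> (ubar K) ss' - \<L> xs' (sbar K) \<le> ereal (C xs' ss' / real K)" using C K by blast
qed

end
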